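(* Let $\eta_{\max},\delta,\alpha\in(0,1)$ and let $D$ be a distribution over $[0,1]\times\{-1,+1\}$ with $\mathrm{err}(D,\mathcal{H}_{\dashv})\le\eta_{\max}$. The Auditing-for-Thresholds algorithm below, run with inputs $\eta_{\max},\delta,\alpha$, has auditing complexity $O(\ln(1/\delta)/\alpha^2)$, and with probability at least $1-\delta$ it returns $\hat h$ with $\mathrm{err}(D,\hat h)\le(1+\alpha)\eta_{\max}$.
   Context: Setting: an algorithm may draw i.i.d. pairs $(X,Y)\sim D$; it sees $X$ but $Y$ is hidden until the algorithm queries it. The auditing complexity is the number of queries made on points whose label is $-1$. For $a\in[0,1]$, $h_a(x)=+1$ if $x\ge a$ and $-1$ otherwise; $\mathcal{H}_{\dashv}=\{h_a:a\in[0,1]\}$. $\mathrm{err}(D,h)=\Pr_{(X,Y)\sim D}[h(X)\ne Y]$, $\mathrm{err}(S,h)=\frac1{|S|}\sum_{(x,y)\in S}\mathbb{I}[h(x)\ne y]$ for a multiset $S$, and $\mathrm{err}(D,\mathcal{H})=\min_{h\in\mathcal{H}}\mathrm{err}(D,h)$. Sample sizes (with $C,c>0$ fixed universal constants): $m^{\mathrm{ag}}(\epsilon,\delta,d)=C(d+\ln(c/\delta))/\epsilon^2$, and $m_\nu(\epsilon,\delta,d)=C(d\ln(c/(\nu\epsilon))+\ln(c/\delta))/(\nu^2\epsilon)$. Representative Subset Selection (input: pool $S=(x_1,\ldots,x_m)$ with hidden labels, $\eta'\in(0,1]$, $\delta'\in(0,1)$): $T=\max\{\lfloor1/(3\eta')\rfloor,1\}$;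 let $U$ contain $T$ copies of each point of $S$, sorted as $x'_1\le\cdots\le x'_{Tm}$; for $t=1,\ldots,T$ let $S(t)=\{x'_{(t-1)m+1},\ldots,x'_{tm}\}$ and add $14\ln(8/\delta')$ points drawn independently uniformly at random from $S(t)$ to $S_q$ (with duplications); output $S_q$ with its hidden labels. Auditing-for-Thresholds algorithm (input $\eta_{\max},\delta,\alpha$): (1) $\nu\leftarrow\alpha/5$. (2) Draw a pool $S_0$ of size $m_\nu(\eta_{\max},\delta/2,1)$ i.i.d. from $D$ (labels hidden). (3) Draw a sample $S$ of size $m^{\mathrm{ag}}((1+\nu)\eta_{\max},\delta/2,1)$ uniformly from $S_0$. (4) Obtain $S_q$ by Representative Subset Selection with inputs $S,\,2(1+\nu)\eta_{\max},\,\delta/2$. (5) Query the points of $S_q$ from highest to lowest, stopping after $\lceil12|S_q|(1+\nu)\eta_{\max}\rceil+1$ negative labels. (6) Find $\hat a$ such that $h_{\hat a}$ minimizes the error on the labeled part of $S_q$. (7) Let $S_1$ be the set of the $36(1+\nu)\eta_{\max}|S_0|$ points of $S_0$ closest to $\hat a$ on each side of $\hat a$. (8) Draw $S_2$ of size $m^{\mathrm{ag}}(\nu/72,\delta/2,1)$ from $S_1$. (9) Query all points of $S_2$ and return $\hat h\in\mathcal{H}_{\dashv}$ minimizing the error on $S_2$.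
   Formalization: The auditing complexity is bounded by a constant times (1+ln(1/δ))/α², since ln(1/δ) tends to 0 as δ tends to 1 while the algorithm still queries; C and c are any sufficiently large constants, sample sizes are rounded up, and err(D,H) is an infimum. *)

theory Defs
  imports "HOL-Probability.Probability"
begin

type_synonym point = "real \<times> int"   (* (x, y) with y \<in> {-1, +1} *)

definition thr :: "real \<Rightarrow> real \<Rightarrow> int" where
  "thr a x = (if x \<ge> a then 1 else -1)"

definition err_D :: "point measure \<Rightarrow> (real \<Rightarrow> int) \<Rightarrow> real" where
  "err_D D h = measure D {p. h (fst p) \<noteq> snd p}"

definition err_H :: "point measure \<Rightarrow> real" where
  "err_H D = (INF a\<in>{0..1}. err_D D (thr a))"

definition err_S :: "point list \<Rightarrow> (real \<Rightarrow> int) \<Rightarrow> real" where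
  "err_S S h = real (length (filter (\<lambda>p. h (fst p) \<noteq> snd p) S)) / real (length S)"

definition erm :: "point list \<Rightarrow> real" where
  "erm S = (SOME a. a \<in> {0..1} \<and> (\<forall>b\<in>{0..1}. err_S S (thr a) \<le> err_S S (thr b)))"

definition m_ag :: "real \<Rightarrow> real \<Rightarrow> real \<Rightarrow> real \<Rightarrow> real \<Rightarrow> real" where
  "m_ag C c \<epsilon> \<delta> d = C * (d + ln (c / \<delta>)) / \<epsilon>\<^sup>2"

definition m_nu :: "real \<Rightarrow> real \<Rightarrow> real \<Rightarrow> real \<Rightarrow> real \<Rightarrow> real \<Rightarrow> real" where
  "m_nu C c \<nu> \<epsilon> \<delta> d = C * (d * ln (c / (\<nu> * \<epsilon>)) + ln (c / \<delta>)) / (\<nu>\<^sup>2 * \<epsilon>)"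

fun iid_pmf :: "nat \<Rightarrow> 'a pmf \<Rightarrow> 'a list pmf" where
  "iid_pmf 0 p = return_pmf []"
| "iid_pmf (Suc k) p = bind_pmf p (\<lambda>x. bind_pmf (iid_pmf k p) (\<lambda>xs. return_pmf (x # xs)))"

fun seq_pmf :: "'a pmf list \<Rightarrow> 'a list pmf" where
  "seq_pmf [] = return_pmf []"
| "seq_pmf (p # ps) = bind_pmf p (\<lambda>x. bind_pmf (seq_pmf ps) (\<lambda>xs. return_pmf (x # xs)))"

definition unif_list :: "'a list \<Rightarrow> 'a pmf" where
  "unif_list xs = map_pmf (\<lambda>i. xs ! i) (pmf_of_set {..<length xs})"

definition rss_pmf :: "real \<Rightarrow> real \<Rightarrow> point list \<Rightarrow> point list pmf" where
  "rss_pmf \<eta>' \<delta>' S =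
     (let T = max (nat \<lfloor>1 / (3 * \<eta>')\<rfloor>) 1;
          m = length S;
          k = nat \<lceil>14 * ln (8 / \<delta>')\<rceil>;
          U = sort_key fst (concat (replicate T S));
          blocks = map (\<lambda>t. take m (drop (t * m) U)) [0..<T]
      in map_pmf concat (seq_pmf (map (\<lambda>B. iid_pmf k (unif_list B)) blocks)))"

fun take_negs :: "nat \<Rightarrow> point list \<Rightarrow> point list" where
  "take_negs N [] = []"
| "take_negs N (p # ps) =
     (if snd p = -1 then (if N \<le> 1 then [p] else p # take_negs (N - 1) ps)
      else p # take_negs N ps)"

definition count_neg :: "point list \<Rightarrow> nat" where
  "count_neg S = length (filter (\<lambda>p. snd p = -1) S)"

definition pool_size :: "real \<Rightarrow> real \<Rightarrow> real \<Rightarrow> real \<Rightarrow> real \<Rightarrow> nat" where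
  "pool_size C c \<eta> \<delta> \<alpha> = nat \<lceil>m_nu C c (\<alpha> / 5) \<eta> (\<delta> / 2) 1\<rceil>"

(* Steps (3)-(9) of Auditing-for-Thresholds, given the pool S0 (labels hidden, revealed only
   for queried points).  Output: (threshold of h-hat, number of queries on negative points). *)
definition audit_thr :: "real \<Rightarrow> real \<Rightarrow> real \<Rightarrow> real \<Rightarrow> real \<Rightarrow> point list \<Rightarrow> (real \<times> nat) pmf" where
  "audit_thr C c \<eta> \<delta> \<alpha> S0 =
     (let \<nu> = \<alpha> / 5;
          n = nat \<lceil>m_ag C c ((1 + \<nu>) * \<eta>) (\<delta> / 2) 1\<rceil>;
          n2 = nat \<lceil>m_ag C c (\<nu> / 72) (\<delta> / 2) 1\<rceil>;
          r = nat \<lceil>36 * (1 + \<nu>) * \<eta> * real (length S0)\<rceil>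
      in bind_pmf (iid_pmf n (unif_list S0)) (\<lambda>S.
         bind_pmf (rss_pmf (2 * (1 + \<nu>) * \<eta>) (\<delta> / 2) S) (\<lambda>Sq.
           let N = nat \<lceil>12 * real (length Sq) * (1 + \<nu>) * \<eta>\<rceil> + 1;
               L = take_negs N (rev (sort_key fst Sq));
               a = erm L;
               S1 = take r (rev (sort_key fst (filter (\<lambda>p. fst p < a) S0)))
                    @ take r (sort_key fst (filter (\<lambda>p. fst p \<ge> a) S0))
           in bind_pmf (iid_pmf n2 (unif_list S1)) (\<lambda>S2.
                return_pmf (erm S2, count_neg L + count_neg S2)))))"

end

theory Submission
  imports Defs
begin

text \<open>
  Fix a threshold \<open>a\<close> whose true error is within a factor \<open>1 + \<nu>/8\<close> of \<open>\<eta>\<close> (the infimum over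
  thresholds need not be attained). Finitely many quantile brackets and a multiplicative Chernoff bound
  show that the pool estimates every threshold well enough: \<open>a\<close> has few errors on the pool, and any
  threshold with pool error at most \<open>(1 + 2\<nu>)\<eta>\<close> has true error at most \<open>(1 + \<alpha>)\<eta>\<close>.

  In the representative subset each of the \<open>T\<close> blocks contributes \<open>k\<close> points, while \<open>a\<close> errs on fewer
  than \<open>k/2\<close> points in total. The empirical minimiser on the queried part therefore disagrees with \<open>a\<close>
  on fewer than \<open>k\<close> points, so no whole block lies between the two thresholds, and the first estimate is
  within \<open>33(1 + \<nu>)\<eta>|S0|\<close> pool points of \<open>a\<close>. Hence a threshold that disagrees with \<open>a\<close> outside the
  window \<open>S1\<close> has far too many errors inside it, and minimising the error on \<open>S1\<close> is as good as
  minimising it on the pool.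

  The sample size for the last step carries no factor \<open>ln (1/\<nu>)\<close>, so a union bound over thresholds is too
  weak there. After symmetrisation by a ghost sample the error differences along the ordered thresholds are
  the prefixes of a random walk, for which an exponential maximal inequality holds.
\<close>

section \<open>Independent draws and Chernoff bounds\<close>

lemma iid_pmf_support:
  assumes "xs \<in> set_pmf (iid_pmf n p)"
  shows "length xs = n" "set xs \<subseteq> set_pmf p"
  using assms by (induction n arbitrary: xs) fastforce+

text \<open>Exponential moments of independent draws factorise. Values in \<open>ennreal\<close>
  avoid integrability side conditions.\<close>

lemma nn_integral_iid_pmf:
  "(\<integral>\<^sup>+xs. prod_list (map g xs) \<partial>iid_pmf n p) = (\<integral>\<^sup>+x. g x \<partial>p) ^ n"
  for g :: "'a \<Rightarrow> ennreal"
  by (induction n)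
     (simp_all add: nn_integral_cmult nn_integral_multc)

lemma nn_integral_seq_pmf:
  "(\<integral>\<^sup>+xs. prod_list (map g xs) \<partial>seq_pmf ps) = prod_list (map (\<lambda>p. \<integral>\<^sup>+x. g x \<partial>measure_pmf p) ps)"
  for g :: "'a \<Rightarrow> ennreal"
  by (induction ps)
     (simp_all add: nn_integral_cmult nn_integral_multc)

lemma seq_pmf_support:
  assumes "xs \<in> set_pmf (seq_pmf ps)"
  shows "list_all2 (\<lambda>x p. x \<in> set_pmf p) xs ps"
  using assms by (induction ps arbitrary: xs) auto

lemma iid_pmf_map: "iid_pmf n (map_pmf g p) = map_pmf (map g) (iid_pmf n p)"
  by (induction n) (simp_all add: map_bind_pmf bind_map_pmf)

text \<open>Serves two purposes: with \<open>q = p\<close> it splits a sample of pairs into a sample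
  and its ghost sample, and with a fair coin for \<open>q\<close> it attaches independent
  signs.\<close>

lemma iid_pmf_pair:
  "iid_pmf n (pair_pmf p q) = bind_pmf (iid_pmf n p) (\<lambda>xs. map_pmf (zip xs) (iid_pmf n q))"
proof (induction n)
  case (Suc n)
  have "iid_pmf (Suc n) (pair_pmf p q) =
     do {x \<leftarrow> p; y \<leftarrow> q; xs \<leftarrow> iid_pmf n p; ys \<leftarrow> iid_pmf n q; return_pmf ((x,y) # zip xs ys)}"
    unfolding iid_pmf.simps Suc by (simp add: pair_pmf_def bind_assoc_pmf bind_return_pmf map_pmf_def)
  also have "\<dots> = do {x \<leftarrow> p; xs \<leftarrow> iid_pmf n p; y \<leftarrow> q; ys \<leftarrow> iid_pmf n q; return_pmf ((x,y) # zip xs ys)}"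
    by (subst bind_commute_pmf[of q]) simp
  finally show ?case
    by (simp add: bind_assoc_pmf bind_return_pmf map_pmf_def)
qed simp

text \<open>As a function on the index set, a list of coin flips can be revealed in any order of the
  indices.\<close>

lemma iid_pmf_eq_Pi_pmf:
  assumes "distinct js"
  shows "iid_pmf (length js) p = map_pmf (\<lambda>f. map f js) (Pi_pmf (set js) d (\<lambda>_. p))"
  using assms
proof (induction js)
  case (Cons i js)
  have "map (f(i := y)) js = map f js" for f :: "'a \<Rightarrow> 'b" and y
    using Cons.prems by auto
  thus ?case using Cons
    by (simp add: Pi_pmf_insert map_pmf_def pair_pmf_def bind_assoc_pmf bind_return_pmf)
qed simp

text \<open>Union bound for one stage of a random procedure: \<open>A\<close> collects the bad first
  draws, where the conditional probability is bounded by 1.\<close>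

lemma prob_bind_pmf_le:
  assumes "0 \<le> b" "\<And>x. x \<in> set_pmf p \<Longrightarrow> x \<notin> A \<Longrightarrow> measure_pmf.prob (f x) B \<le> b"
  shows "measure_pmf.prob (bind_pmf p f) B \<le> measure_pmf.prob p A + b"
proof -
  have "emeasure (bind_pmf p f) B = (\<integral>\<^sup>+x. emeasure (f x) B \<partial>p)"
    by (simp add: measure_pmf_bind emeasure_bind[where N="count_space UNIV"] measure_pmf_in_subprob_space)
  also have "\<dots> \<le> (\<integral>\<^sup>+x. indicator A x + ennreal b \<partial>p)"
  proof (rule nn_integral_mono_AE, rule AE_pmfI)
    fix x assume x: "x \<in> set_pmf p"
    show "emeasure (f x) B \<le> indicator A x + ennreal b"
    proof (cases "x \<in> A")
      case True
      have "emeasure (f x) B \<le> 1" by (rule measure_pmf.emeasure_le_1)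
      thus ?thesis using True by (simp add: add_increasing2)
    next
      case False
      thus ?thesis using assms(2)[OF x False]
        by (simp add: measure_pmf.emeasure_eq_measure ennreal_leI)
    qed
  qed
  also have "\<dots> = ennreal (measure_pmf.prob p A + b)"
    using assms(1) by (simp add: nn_integral_add measure_pmf.emeasure_eq_measure)
  finally show ?thesis
    using assms(1) by (simp add: measure_pmf.emeasure_eq_measure flip: ennreal_plus)
qed

lemma prob_bind_pmf_ge:
  assumes "0 \<le> b" "\<And>x. x \<in> set_pmf p \<Longrightarrow> x \<in> A \<Longrightarrow> b \<le> measure_pmf.prob (f x) B"
  shows "b * measure_pmf.prob p A \<le> measure_pmf.prob (bind_pmf p f) B"
proof -
  have "ennreal (b * measure_pmf.prob p A) = (\<integral>\<^sup>+x. ennreal b * indicator A x \<partial>p)"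
    using assms(1) by (simp add: nn_integral_cmult measure_pmf.emeasure_eq_measure ennreal_mult)
  also have "\<dots> \<le> (\<integral>\<^sup>+x. emeasure (f x) B \<partial>p)"
    using assms(2) by (intro nn_integral_mono_AE AE_pmfI)
      (auto simp: measure_pmf.emeasure_eq_measure ennreal_leI split: split_indicator)
  also have "\<dots> = emeasure (bind_pmf p f) B"
    by (simp add: measure_pmf_bind emeasure_bind[where N="count_space UNIV"] measure_pmf_in_subprob_space)
  finally show ?thesis
    by (simp add: measure_pmf.emeasure_eq_measure)
qed

section \<open>Exponential moments and tail bounds\<close>

lemma exp_le_quadratic:
  fixes x :: real
  assumes "\<bar>x\<bar> \<le> 1"
  shows "exp x \<le> 1 + x + x\<^sup>2"
proof (cases "0 \<le> x")
  case True
  thus ?thesis using assms by (intro exp_bound) auto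
next
  case False
  define y where "y = - x"
  have y: "0 < y" "y \<le> 1" using False assms by (auto simp: y_def)
  \<comment> \<open>For \<open>x = -y\<close> the claim reads
    \<open>1 \<le> exp y * (1 - y + y\<^sup>2)\<close>. With the quadratic Taylor polynomial in
    place of \<open>exp y\<close>, the linear term of the product cancels and the others are
    nonnegative.\<close>
  have "1 \<le> 1 + y\<^sup>2 / 2 + y^3 / 2 + y^4 / 2" using y by simp
  also have "\<dots> = (1 + y + y\<^sup>2 / 2) * (1 - y + y\<^sup>2)"
    by (simp add: field_simps power2_eq_square power3_eq_cube power4_eq_xxxx)
  also have "\<dots> \<le> exp y * (1 - y + y\<^sup>2)"
    using y exp_lower_Taylor_quadratic[of y] by (intro mult_right_mono) (auto intro: add_nonneg_nonneg)
  finally have "exp (- y) \<le> 1 - y + y\<^sup>2"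
    by (simp add: exp_minus field_simps)
  thus ?thesis by (simp add: y_def)
qed

text \<open>The moment generating function of a Bernoulli variable. Both signs of \<open>l\<close>
  are allowed, so the bound serves upper and lower tails, for a \<open>pmf\<close> as well as for a
  general measure.\<close>

lemma (in prob_space) nn_integral_exp_indicator_le:
  assumes A: "A \<in> events" and l: "\<bar>l\<bar> \<le> 1"
  shows "(\<integral>\<^sup>+x. ennreal (exp (l * indicator A x)) \<partial>M) \<le> ennreal (exp ((l + l\<^sup>2) * prob A))"
proof -
  have "(\<integral>\<^sup>+x. ennreal (exp (l * indicator A x)) \<partial>M) =
        (\<integral>\<^sup>+x. ennreal (exp l) * indicator A x + indicator (space M - A) x \<partial>M)"
    by (intro nn_integral_cong) (auto split: split_indicator)
  also have "\<dots> = ennreal (exp l * prob A + (1 - prob A))"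
    using A by (simp add: nn_integral_add nn_integral_cmult emeasure_eq_measure prob_compl ennreal_mult)
  also have "exp l * prob A + (1 - prob A) = 1 + (exp l - 1) * prob A"
    by (simp add: algebra_simps)
  also have "\<dots> \<le> 1 + (l + l\<^sup>2) * prob A"
    using exp_le_quadratic[OF l] by (intro add_left_mono mult_right_mono) auto
  also have "\<dots> \<le> exp ((l + l\<^sup>2) * prob A)" by (rule exp_ge_add_one_self)
  finally show ?thesis by (simp add: ennreal_leI)
qed

lemma iid_pmf_Chernoff:
  fixes p :: "'a pmf"
  assumes "(\<integral>\<^sup>+x. ennreal (exp (f x)) \<partial>p) \<le> ennreal (exp K)"
  shows "measure_pmf.prob (iid_pmf n p) {xs. t \<le> sum_list (map f xs)} \<le> exp (real n * K - t)"
proof -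
  have e: "ennreal (exp (sum_list (map f xs))) = prod_list (map (\<lambda>x. ennreal (exp (f x))) xs)" for xs
    by (induction xs) (simp_all add: exp_add ennreal_mult)
  have "emeasure (iid_pmf n p) {xs\<in>UNIV. 1 \<le> ennreal (exp (- t)) * ennreal (exp (sum_list (map f xs)))}
     \<le> ennreal (exp (- t)) * (\<integral>\<^sup>+ xs. ennreal (exp (sum_list (map f xs))) * indicator UNIV xs \<partial>iid_pmf n p)"
    by (rule nn_integral_Markov_inequality) auto
  also have "\<dots> = ennreal (exp (- t)) * (\<integral>\<^sup>+x. ennreal (exp (f x)) \<partial>p) ^ n"
    by (simp add: e nn_integral_iid_pmf)
  also have "\<dots> \<le> ennreal (exp (- t)) * ennreal (exp K) ^ n"
    using assms by (intro mult_left_mono power_mono) auto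
  also have "\<dots> = ennreal (exp (real n * K - t))"
    by (simp add: ennreal_power exp_of_nat_mult[symmetric] ennreal_mult[symmetric] exp_add[symmetric] mult.commute)
  also have "{xs\<in>UNIV. 1 \<le> ennreal (exp (- t)) * ennreal (exp (sum_list (map f xs)))} = {xs. t \<le> sum_list (map f xs)}"
    by (auto simp: ennreal_mult[symmetric] exp_add[symmetric])
  finally show ?thesis
    by (simp add: measure_pmf.emeasure_eq_measure)
qed

lemma sum_list_indicator_eq:
  "sum_list (map (\<lambda>x. l * indicator {x. P x} x) xs) = l * real (length (filter P xs))"
  by (induction xs) (auto simp: algebra_simps)

lemma iid_pmf_count_upper:
  assumes "measure_pmf.prob p {x. P x} \<le> r" "0 \<le> l" "l \<le> 1"
  shows "measure_pmf.prob (iid_pmf n p) {xs. real n * q \<le> real (length (filter P xs))}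
    \<le> exp (real n * ((l + l\<^sup>2) * r - l * q))"
proof -
  have "(\<integral>\<^sup>+x. ennreal (exp (l * indicator {x. P x} x)) \<partial>p) \<le> ennreal (exp ((l + l\<^sup>2) * measure_pmf.prob p {x. P x}))"
    using assms by (intro measure_pmf.nn_integral_exp_indicator_le) auto
  also have "\<dots> \<le> ennreal (exp ((l + l\<^sup>2) * r))"
    using assms by (intro ennreal_leI) (simp add: mult_left_mono)
  finally have "measure_pmf.prob (iid_pmf n p) {xs. l * (real n * q) \<le> sum_list (map (\<lambda>x. l * indicator {x. P x} x) xs)}
    \<le> exp (real n * ((l + l\<^sup>2) * r) - l * (real n * q))"
    by (rule iid_pmf_Chernoff)
  moreover have "measure_pmf.prob (iid_pmf n p) {xs. real n * q \<le> real (length (filter P xs))} \<le>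
    measure_pmf.prob (iid_pmf n p) {xs. l * (real n * q) \<le> sum_list (map (\<lambda>x. l * indicator {x. P x} x) xs)}"
    using assms by (intro measure_pmf.finite_measure_mono) (auto simp: sum_list_indicator_eq mult_left_mono)
  ultimately show ?thesis by (simp add: algebra_simps)
qed

lemma iid_pmf_count_lower:
  assumes "r \<le> measure_pmf.prob p {x. P x}" "0 \<le> l" "l \<le> 1"
  shows "measure_pmf.prob (iid_pmf n p) {xs. real (length (filter P xs)) \<le> real n * q}
    \<le> exp (real n * (l * q - (l - l\<^sup>2) * r))"
proof -
  have "(\<integral>\<^sup>+x. ennreal (exp (- l * indicator {x. P x} x)) \<partial>p) \<le> ennreal (exp ((- l + (- l)\<^sup>2) * measure_pmf.prob p {x. P x}))"
    using assms by (intro measure_pmf.nn_integral_exp_indicator_le) auto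
  also have "\<dots> \<le> ennreal (exp (- (l - l\<^sup>2) * r))"
  proof -
    have "(l - l\<^sup>2) * r \<le> (l - l\<^sup>2) * measure_pmf.prob p {x. P x}"
      using assms by (intro mult_left_mono) (auto simp: power2_eq_square mult_left_le)
    thus ?thesis by (intro ennreal_leI) (simp add: algebra_simps)
  qed
  finally have "measure_pmf.prob (iid_pmf n p) {xs. - l * (real n * q) \<le> sum_list (map (\<lambda>x. - l * indicator {x. P x} x) xs)}
    \<le> exp (real n * (- (l - l\<^sup>2) * r) - (- l * (real n * q)))"
    by (rule iid_pmf_Chernoff)
  moreover have "measure_pmf.prob (iid_pmf n p) {xs. real (length (filter P xs)) \<le> real n * q} \<le>
    measure_pmf.prob (iid_pmf n p) {xs. - l * (real n * q) \<le> sum_list (map (\<lambda>x. - l * indicator {x. P x} x) xs)}"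
    unfolding sum_list_indicator_eq
    using assms by (intro measure_pmf.finite_measure_mono) (auto simp: mult_left_mono)
  ultimately show ?thesis by (simp add: algebra_simps)
qed

section \<open>Uniform deviation over a chain\<close>

lemma prob_bind_fair_coin:
  "measure_pmf.prob (bind_pmf (bernoulli_pmf (1/2)) f) B =
   (measure_pmf.prob (f True) B + measure_pmf.prob (f False) B) / 2"
proof -
  have "emeasure (bind_pmf (bernoulli_pmf (1/2)) f) B = (\<integral>\<^sup>+x. emeasure (f x) B \<partial>bernoulli_pmf (1/2))"
    by (simp add: measure_pmf_bind emeasure_bind[where N="count_space UNIV"] measure_pmf_in_subprob_space)
  also have "\<dots> = ennreal ((measure_pmf.prob (f True) B + measure_pmf.prob (f False) B) / 2)"
    by (simp add: measure_pmf.emeasure_eq_measure add_divide_distrib ennreal_divide_numeral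
        flip: divide_ennreal_def)
  finally show ?thesis
    by (simp add: measure_pmf.emeasure_eq_measure flip: ennreal_plus)
qed

text \<open>Signs are revealed in the order of \<open>h\<close>, so the initial segments become the prefixes of a
  random walk; no union bound over the segments is needed.\<close>
lemma random_signs_maximal_inequality:
  fixes h w :: "'i \<Rightarrow> real"
  assumes "finite I" "\<And>i. \<bar>w i\<bar> \<le> 1" and u: "0 \<le> u" "u \<le> 1"
  shows "measure_pmf.prob (Pi_pmf I False (\<lambda>_. bernoulli_pmf (1/2)))
     {s. \<exists>J\<subseteq>I. (\<forall>i\<in>J. \<forall>j\<in>I. h j \<le> h i \<longrightarrow> j \<in> J) \<and> t \<le> (\<Sum>i\<in>J. if s i then w i else - w i)}
     \<le> exp (real (card I) * u\<^sup>2 - u * t)"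
  using assms(1)
proof (induction "card I" arbitrary: I t)
  case 0
  hence I: "I = {}" by simp
  show ?case
  proof (cases "t \<le> 0")
    case True
    have "1 \<le> exp (real (card I) * u\<^sup>2 - u * t)"
      using True u I by (simp add: mult_nonneg_nonpos)
    thus ?thesis using order_trans measure_pmf.prob_le_1 by blast
  next
    case False
    thus ?thesis by (simp add: I)
  qed
next
  case (Suc n)
  show ?case
  \<comment> \<open>For \<open>t \<le> 0\<close> the empty segment lies in the event, but the bound
    is at least 1. For \<open>t > 0\<close> the segment must be nonempty.\<close>
  proof (cases "t \<le> 0")
    case True
    have "0 \<le> real (card I) * u\<^sup>2 - u * t"
      using True u mult_nonneg_nonpos[of u t] zero_le_power2[of u]
      by (smt (verit) mult_nonneg_nonneg of_nat_0_le_iff)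
    hence "1 \<le> exp (real (card I) * u\<^sup>2 - u * t)" by simp
    thus ?thesis using order_trans measure_pmf.prob_le_1 by blast
  next
    case False
    have "I \<noteq> {}" using Suc by auto
    \<comment> \<open>Every nonempty initial segment contains a least index, so the sign of
      \<open>i0\<close> always counts and can be revealed first.\<close>
    then obtain i0 where i0: "i0 \<in> I" "\<And>i. i \<in> I \<Longrightarrow> h i0 \<le> h i"
      using Suc.prems by (metis arg_min_if_finite(1) arg_min_least)
    define I' where "I' = I - {i0}"
    have I': "I = insert i0 I'" "i0 \<notin> I'" "finite I'" "card I' = n"
      using i0 Suc by (auto simp: I'_def)
    define ev where "ev I t = {s. \<exists>J\<subseteq>I. (\<forall>i\<in>J. \<forall>j\<in>I. h j \<le> h i \<longrightarrow> j \<in> J) \<and>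
       t \<le> (\<Sum>i\<in>J. if s i then w i else - w i)}" for I t
    \<comment> \<open>Fixing the sign of \<open>i0\<close> leaves the same event on
      \<open>I'\<close>, with the target lowered by the step just made; hence the induction
      generalises \<open>t\<close>.\<close>
    have sub: "f \<in> ev I' (t - (if b then w i0 else - w i0))" if asm: "f(i0 := b) \<in> ev I t" for f b
    proof -
      obtain J where J: "J \<subseteq> I" "\<forall>i\<in>J. \<forall>j\<in>I. h j \<le> h i \<longrightarrow> j \<in> J"
        "t \<le> (\<Sum>i\<in>J. if (f(i0 := b)) i then w i else - w i)"
        using asm unfolding ev_def by blast
      have "J \<noteq> {}" using J(3) False by auto
      hence "i0 \<in> J" using J i0 by blast
      have "finite J" using J(1) Suc.prems finite_subset by blast
      have "(\<Sum>i\<in>J. if (f(i0 := b)) i then w i else - w i) =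
        (if b then w i0 else - w i0) + (\<Sum>i\<in>J - {i0}. if (f(i0 := b)) i then w i else - w i)"
        using \<open>i0 \<in> J\<close> \<open>finite J\<close> by (subst sum.remove[of J i0]) auto
      also have "(\<Sum>i\<in>J - {i0}. if (f(i0 := b)) i then w i else - w i) = (\<Sum>i\<in>J - {i0}. if f i then w i else - w i)"
        by (intro sum.cong) auto
      finally show ?thesis
        using J unfolding ev_def I'_def by (intro CollectI exI[of _ "J - {i0}"]) auto
    qed
    let ?P = "\<lambda>I. Pi_pmf I False (\<lambda>_. bernoulli_pmf (1/2))"
    have bd: "measure_pmf.prob (map_pmf (\<lambda>f. f(i0 := b)) (?P I')) (ev I t)
        \<le> exp (real n * u\<^sup>2 - u * (t - (if b then w i0 else - w i0)))" for b
    proof -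
      have "measure_pmf.prob (map_pmf (\<lambda>f. f(i0 := b)) (?P I')) (ev I t)
         \<le> measure_pmf.prob (?P I') (ev I' (t - (if b then w i0 else - w i0)))"
        unfolding measure_map_pmf
        by (intro measure_pmf.finite_measure_mono subsetI sub) (simp_all only: vimage_eq sets_measure_pmf UNIV_I)
      also have "\<dots> \<le> exp (real n * u\<^sup>2 - u * (t - (if b then w i0 else - w i0)))"
        using Suc.hyps(1)[of I'] I' unfolding ev_def by auto
      finally show ?thesis .
    qed
    have sq: "(u * w i0)\<^sup>2 \<le> u\<^sup>2"
      using assms(2)[of i0] by (simp add: power_mult_distrib mult_left_le abs_square_le_1)
    have "\<bar>u * w i0\<bar> \<le> 1"
      using u assms(2)[of i0] by (simp add: abs_mult mult_le_one)
    \<comment> \<open>The linear terms of opposite signs cancel, so one step of the walk costs a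
      factor \<open>exp (u\<^sup>2)\<close>.\<close>
    hence "exp (u * w i0) + exp (- (u * w i0)) \<le> 2 * (1 + (u * w i0)\<^sup>2)"
      using exp_le_quadratic[of "u * w i0"] exp_le_quadratic[of "- (u * w i0)"] by simp
    also have "\<dots> \<le> 2 * (1 + u\<^sup>2)" using sq by simp
    also have "\<dots> \<le> 2 * exp (u\<^sup>2)" by (intro mult_left_mono exp_ge_add_one_self) simp
    finally have ch: "exp (u * w i0) + exp (- (u * w i0)) \<le> 2 * exp (u\<^sup>2)" .
    have "measure_pmf.prob (?P I) (ev I t) =
       measure_pmf.prob (bind_pmf (bernoulli_pmf (1/2)) (\<lambda>b. map_pmf (\<lambda>f. f(i0 := b)) (?P I'))) (ev I t)"
      using I' by (simp add: Pi_pmf_insert' map_pmf_def)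
    also have "\<dots> \<le> (exp (real n * u\<^sup>2 - u * (t - w i0)) + exp (real n * u\<^sup>2 - u * (t + w i0))) / 2"
      unfolding prob_bind_fair_coin using bd[of True] bd[of False] by simp
    also have "\<dots> = exp (real n * u\<^sup>2 - u * t) * ((exp (u * w i0) + exp (- (u * w i0))) / 2)"
      by (simp add: algebra_simps flip: exp_add)
    also have "\<dots> \<le> exp (real n * u\<^sup>2 - u * t) * exp (u\<^sup>2)"
      using ch by (intro mult_left_mono) auto
    also have "\<dots> = exp (real (card I) * u\<^sup>2 - u * t)"
      using I' by (simp add: algebra_simps flip: exp_add)
    finally show ?thesis unfolding ev_def .
  qed
qed

text \<open>Swapping the entries of each pair by an independent fair coin leaves the distribution
  unchanged. With the pairs fixed, the sum becomes two signed walks, one over the second entries and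
  one over the first.\<close>

lemma symmetrized_chain_deviation:
  fixes h w :: "'a \<Rightarrow> real"
  assumes w: "\<And>z. \<bar>w z\<bar> \<le> 1" and e: "0 < e" "e \<le> 1"
  shows "measure_pmf.prob (iid_pmf n (pair_pmf p p))
     {zz. \<exists>Q. (\<forall>x y. Q x \<longrightarrow> h y \<le> h x \<longrightarrow> Q y) \<and>
        real n * e / 2 \<le> (\<Sum>(x, y)\<leftarrow>zz. w y * of_bool (Q y) - w x * of_bool (Q x))}
     \<le> 2 * exp (- real n * e\<^sup>2 / 64)" (is "measure_pmf.prob _ ?G \<le> _")
proof -
  let ?co = "bernoulli_pmf (1/2)"
  define g :: "('a \<times> 'a) \<times> bool \<Rightarrow> 'a \<times> 'a" where "g = (\<lambda>(z, s). if s then z else prod.swap z)"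
  have sym: "map_pmf g (pair_pmf (pair_pmf p p) ?co) = pair_pmf p p"
  proof -
    have inv: "map_pmf (\<lambda>z. g (z, s)) (pair_pmf p p) = pair_pmf p p" for s
    proof (cases s)
      case False
      have "pair_pmf p p = map_pmf prod.swap (pair_pmf p p)"
        by (subst pair_commute_pmf) (intro map_pmf_cong, auto)
      thus ?thesis using False by (simp add: g_def)
    qed (simp add: g_def)
    have "map_pmf g (pair_pmf (pair_pmf p p) ?co) =
      bind_pmf ?co (\<lambda>s. map_pmf (\<lambda>z. g (z, s)) (pair_pmf p p))"
      unfolding map_pmf_def
      by (subst pair_pmf_def, subst bind_commute_pmf) (simp add: bind_assoc_pmf bind_return_pmf)
    also have "\<dots> = pair_pmf p p" unfolding inv by simp
    finally show ?thesis .
  qed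
  let ?P = "Pi_pmf {..<n} False (\<lambda>_. ?co)"
  have fixed: "measure_pmf.prob (map_pmf (\<lambda>s. map g (zip zz s)) (iid_pmf n ?co)) ?G \<le> 2 * exp (- real n * e\<^sup>2 / 64)"
    if len: "length zz = n" for zz
  proof -
    \<comment> \<open>The total \<open>n * e / 2\<close> is shared between two walks, so one of them
      reaches \<open>n * e / 4\<close>.\<close>
    define ev where "ev w h = {s. \<exists>J\<subseteq>{..<n}. (\<forall>i\<in>J. \<forall>j\<in>{..<n}. h j \<le> h i \<longrightarrow> j \<in> J) \<and>
      real n * e / 4 \<le> (\<Sum>i\<in>J. if s i then w i else - w i)}" for w h :: "nat \<Rightarrow> real"
    let ?u = "\<lambda>i. fst (zz ! i)" and ?v = "\<lambda>i. snd (zz ! i)"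
    have ev: "measure_pmf.prob ?P (ev w' h') \<le> exp (- real n * e\<^sup>2 / 64)"
      if "\<And>i. \<bar>w' i\<bar> \<le> 1" for w' h'
    proof -
      \<comment> \<open>The choice \<open>e / 8\<close> minimises the exponent
        \<open>n * u\<^sup>2 - u * (n * e / 4)\<close>.\<close>
      have "measure_pmf.prob ?P (ev w' h') \<le> exp (real (card {..<n}) * (e / 8)\<^sup>2 - e / 8 * (real n * e / 4))"
        unfolding ev_def using that e by (intro random_signs_maximal_inequality) auto
      also have "real (card {..<n}) * (e / 8)\<^sup>2 - e / 8 * (real n * e / 4) = - real n * e\<^sup>2 / 64"
        by (simp add: power2_eq_square field_simps)
      finally show ?thesis .
    qed
    have "iid_pmf n ?co = map_pmf (\<lambda>f. map f [0..<n]) ?P"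
      using iid_pmf_eq_Pi_pmf[of "[0..<n]" ?co False] by (simp add: atLeast0LessThan)
    hence "map_pmf (\<lambda>s. map g (zip zz s)) (iid_pmf n ?co) = map_pmf (\<lambda>f. map g (zip zz (map f [0..<n]))) ?P"
      by (simp add: map_pmf_comp)
    hence "measure_pmf.prob (map_pmf (\<lambda>s. map g (zip zz s)) (iid_pmf n ?co)) ?G =
       measure_pmf.prob ?P ((\<lambda>f. map g (zip zz (map f [0..<n]))) -` ?G)"
      by (simp only: measure_map_pmf)
    also have "\<dots> \<le> measure_pmf.prob ?P (ev (\<lambda>i. w (?v i)) (\<lambda>i. h (?v i)) \<union> ev (\<lambda>i. - w (?u i)) (\<lambda>i. h (?u i)))"
    proof (intro measure_pmf.finite_measure_mono subsetI)
      fix s assume "s \<in> (\<lambda>f. map g (zip zz (map f [0..<n]))) -` ?G"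
      then obtain Q where Q: "\<forall>x y. Q x \<longrightarrow> h y \<le> h x \<longrightarrow> Q y"
        "real n * e / 2 \<le> (\<Sum>(x, y)\<leftarrow>map g (zip zz (map s [0..<n])). w y * of_bool (Q y) - w x * of_bool (Q x))"
        by auto
      define f where "f z = w z * of_bool (Q z)" for z
      have "(\<Sum>(x, y)\<leftarrow>map g (zip zz (map s [0..<n])). w y * of_bool (Q y) - w x * of_bool (Q x)) =
         (\<Sum>i<n. case g (zz ! i, s i) of (x, y) \<Rightarrow> f y - f x)"
        using len by (simp add: sum_list_sum_nth f_def atLeast0LessThan)
      also have "\<dots> = (\<Sum>i<n. (if s i then f (?v i) else - f (?v i)) + (if s i then - f (?u i) else f (?u i)))"
        by (intro sum.cong) (auto simp: g_def case_prod_beta)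
      finally have "real n * e / 2 \<le> (\<Sum>i<n. if s i then f (?v i) else - f (?v i)) + (\<Sum>i<n. if s i then - f (?u i) else f (?u i))"
        using Q(2) by (simp add: sum.distrib)
      hence "real n * e / 4 \<le> (\<Sum>i<n. if s i then f (?v i) else - f (?v i)) \<or>
             real n * e / 4 \<le> (\<Sum>i<n. if s i then - f (?u i) else f (?u i))" by linarith
      \<comment> \<open>The indices where \<open>Q\<close> holds form an initial segment in the
        order of \<open>h\<close>; outside it the summands vanish.\<close>
      moreover have "(\<Sum>i<n. if s i then f (?v i) else - f (?v i)) =
          (\<Sum>i\<in>{i\<in>{..<n}. Q (?v i)}. if s i then w (?v i) else - w (?v i))"
        by (rule sum.mono_neutral_cong_right) (auto simp: f_def)
      moreover have "(\<Sum>i<n. if s i then - f (?u i) else f (?u i)) =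
          (\<Sum>i\<in>{i\<in>{..<n}. Q (?u i)}. if s i then - w (?u i) else - (- w (?u i)))"
        by (rule sum.mono_neutral_cong_right) (auto simp: f_def)
      ultimately show "s \<in> ev (\<lambda>i. w (?v i)) (\<lambda>i. h (?v i)) \<union> ev (\<lambda>i. - w (?u i)) (\<lambda>i. h (?u i))"
      proof (elim disjE, goal_cases)
        case 1
        thus ?case using Q(1) unfolding ev_def
          by (intro UnI1 CollectI exI[of _ "{i\<in>{..<n}. Q (?v i)}"]) auto
      next
        case 2
        thus ?case using Q(1) unfolding ev_def
          by (intro UnI2 CollectI exI[of _ "{i\<in>{..<n}. Q (?u i)}"]) auto
      qed
    qed simp
    also have "\<dots> \<le> measure_pmf.prob ?P (ev (\<lambda>i. w (?v i)) (\<lambda>i. h (?v i))) + measure_pmf.prob ?P (ev (\<lambda>i. - w (?u i)) (\<lambda>i. h (?u i)))"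
      by (intro measure_Un_le) auto
    also have "\<dots> \<le> exp (- real n * e\<^sup>2 / 64) + exp (- real n * e\<^sup>2 / 64)"
      using w by (intro add_mono ev) auto
    finally show ?thesis by simp
  qed
  have "iid_pmf n (pair_pmf p p) = map_pmf (map g) (iid_pmf n (pair_pmf (pair_pmf p p) ?co))"
    by (metis sym iid_pmf_map)
  also have "\<dots> = bind_pmf (iid_pmf n (pair_pmf p p)) (\<lambda>zz. map_pmf (\<lambda>s. map g (zip zz s)) (iid_pmf n ?co))"
    by (subst iid_pmf_pair) (simp add: map_bind_pmf map_pmf_comp)
  finally have "measure_pmf.prob (iid_pmf n (pair_pmf p p)) ?G =
    measure_pmf.prob (bind_pmf (iid_pmf n (pair_pmf p p)) (\<lambda>zz. map_pmf (\<lambda>s. map g (zip zz s)) (iid_pmf n ?co))) ?G"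
    by simp
  also have "\<dots> \<le> measure_pmf.prob (iid_pmf n (pair_pmf p p)) {} + 2 * exp (- real n * e\<^sup>2 / 64)"
    by (intro prob_bind_pmf_le fixed iid_pmf_support(1)) auto
  finally show ?thesis by simp
qed

lemma iid_pmf_sum_ge_half:
  assumes f: "\<And>z. \<bar>f z\<bar> \<le> 1" and e: "0 < e" "e \<le> 1" "e \<le> measure_pmf.expectation p f"
    and n: "16 \<le> real n * e\<^sup>2"
  shows "1 / 2 \<le> measure_pmf.prob (iid_pmf n p) {zs. real n * e / 2 \<le> sum_list (map f zs)}"
proof -
  \<comment> \<open>This minimises \<open>l\<^sup>2 - l * e / 2\<close>, the rate left after
    Markov's inequality.\<close>
  define l where "l = e / 4"
  have int: "integrable (measure_pmf p) f"
    by (rule measure_pmf.integrable_const_bound[of _ 1]) (use f in auto)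
  have "(\<integral>\<^sup>+x. ennreal (exp (- l * f x)) \<partial>p) \<le> (\<integral>\<^sup>+x. ennreal (1 + l\<^sup>2 - l * f x) \<partial>p)"
  proof (intro nn_integral_mono ennreal_leI)
    fix x
    have "e * \<bar>f x\<bar> \<le> 1" using f[of x] e by (intro mult_le_one) auto
    hence "\<bar>- l * f x\<bar> \<le> 1" using e by (simp add: l_def abs_mult)
    hence "exp (- l * f x) \<le> 1 + - l * f x + (- l * f x)\<^sup>2" by (rule exp_le_quadratic)
    moreover have "(- l * f x)\<^sup>2 \<le> l\<^sup>2"
      using f[of x] by (simp add: power_mult_distrib mult_left_le abs_square_le_1)
    ultimately show "exp (- l * f x) \<le> 1 + l\<^sup>2 - l * f x" by simp
  qed
  also have "\<dots> = ennreal (measure_pmf.expectation p (\<lambda>x. 1 + l\<^sup>2 - l * f x))"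
  proof (rule nn_integral_eq_integral)
    have "l * f x \<le> 1" for x
    proof -
      have "e * f x \<le> e * 1"
        using f[of x] e by (intro mult_left_mono) (auto simp: abs_le_iff)
      thus ?thesis using e unfolding l_def by linarith
    qed
    thus "AE x in p. 0 \<le> 1 + l\<^sup>2 - l * f x" by (simp add: add_increasing2 add_increasing)
  qed (use int in simp)
  also have "measure_pmf.expectation p (\<lambda>x. 1 + l\<^sup>2 - l * f x) = 1 + l\<^sup>2 - l * measure_pmf.expectation p f"
    using int by simp
  also have "\<dots> \<le> 1 + (l\<^sup>2 - l * e)"
    using e by (simp add: l_def)
  also have "\<dots> \<le> exp (l\<^sup>2 - l * e)" by (rule exp_ge_add_one_self)
  finally have "measure_pmf.prob (iid_pmf n p) {zs. - l * (real n * e / 2) \<le> sum_list (map (\<lambda>z. - l * f z) zs)}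
     \<le> exp (real n * (l\<^sup>2 - l * e) - (- l * (real n * e / 2)))"
    by (intro iid_pmf_Chernoff) (simp add: ennreal_leI)
  also have "real n * (l\<^sup>2 - l * e) - (- l * (real n * e / 2)) = - (real n * e\<^sup>2) / 16"
    by (simp add: l_def power2_eq_square field_simps)
  also have "exp (- (real n * e\<^sup>2) / 16) \<le> exp (- 1)"
    using n by simp
  also have "\<dots> \<le> 1 / 2"
    using exp_ge_add_one_self[of 1] by (simp add: exp_minus field_simps)
  finally have a: "measure_pmf.prob (iid_pmf n p) {zs. - l * (real n * e / 2) \<le> sum_list (map (\<lambda>z. - l * f z) zs)} \<le> 1 / 2" .
  have "1 - measure_pmf.prob (iid_pmf n p) {zs. real n * e / 2 \<le> sum_list (map f zs)} =
      measure_pmf.prob (iid_pmf n p) (- {zs. real n * e / 2 \<le> sum_list (map f zs)})"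
    using measure_pmf.prob_compl[of "{zs. real n * e / 2 \<le> sum_list (map f zs)}" "iid_pmf n p"]
    by (simp add: Compl_eq_Diff_UNIV)
  also have "\<dots> \<le> measure_pmf.prob (iid_pmf n p) {zs. - l * (real n * e / 2) \<le> sum_list (map (\<lambda>z. - l * f z) zs)}"
  proof (intro measure_pmf.finite_measure_mono subsetI)
    fix zs assume "zs \<in> - {zs. real n * e / 2 \<le> sum_list (map f zs)}"
    hence "l * sum_list (map f zs) \<le> l * (real n * e / 2)" using e by (intro mult_left_mono) (auto simp: l_def)
    moreover have "sum_list (map (\<lambda>z. - l * f z) zs) = - (l * sum_list (map f zs))"
      by (induction zs) (simp_all add: algebra_simps)
    ultimately show "zs \<in> {zs. - l * (real n * e / 2) \<le> sum_list (map (\<lambda>z. - l * f z) zs)}"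
      by simp
  qed simp
  finally show ?thesis using a by simp
qed

text \<open>Uniform over the chain \<open>Q\<close> without a logarithmic loss: a violation on the sample survives
  against an independent ghost sample with probability at least \<open>1/2\<close>.\<close>
lemma iid_pmf_chain_deviation:
  fixes h w :: "'a \<Rightarrow> real"
  assumes w: "\<And>z. \<bar>w z\<bar> \<le> 1" and e: "0 < e" "e \<le> 1" and n: "16 \<le> real n * e\<^sup>2"
  shows "measure_pmf.prob (iid_pmf n p)
     {zs. \<exists>Q. (\<forall>x y. Q x \<longrightarrow> h y \<le> h x \<longrightarrow> Q y) \<and>
        e \<le> measure_pmf.expectation p (\<lambda>z. w z * of_bool (Q z)) \<and>
        (\<Sum>z\<leftarrow>zs. w z * of_bool (Q z)) \<le> 0}
     \<le> 4 * exp (- real n * e\<^sup>2 / 64)" (is "measure_pmf.prob _ ?B \<le> _")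
proof -
  let ?G = "{zz. \<exists>Q. (\<forall>x y. Q x \<longrightarrow> h y \<le> h x \<longrightarrow> Q y) \<and>
        real n * e / 2 \<le> (\<Sum>(x, y)\<leftarrow>zz. w y * of_bool (Q y) - w x * of_bool (Q x))}"
  have "1 / 2 * measure_pmf.prob (iid_pmf n p) ?B \<le>
    measure_pmf.prob (bind_pmf (iid_pmf n p) (\<lambda>xs. map_pmf (zip xs) (iid_pmf n p))) ?G"
  proof (rule prob_bind_pmf_ge)
    fix xs assume xs: "xs \<in> set_pmf (iid_pmf n p)" "xs \<in> ?B"
    then obtain Q where Q: "\<forall>x y. Q x \<longrightarrow> h y \<le> h x \<longrightarrow> Q y"
      "e \<le> measure_pmf.expectation p (\<lambda>z. w z * of_bool (Q z))"
      "(\<Sum>z\<leftarrow>xs. w z * of_bool (Q z)) \<le> 0" by auto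
    define f where "f z = w z * of_bool (Q z)" for z
    have z: "(\<Sum>(x, y)\<leftarrow>zip xs ys. f y - f x) = sum_list (map f ys) - sum_list (map f xs)"
      if "length xs = length ys" for ys
      using that by (induction xs ys rule: list_induct2) auto
    \<comment> \<open>\<open>Q\<close> was chosen from \<open>xs\<close> alone, so against the ghost
      sample it is one fixed set and a single tail bound suffices.\<close>
    have "1 / 2 \<le> measure_pmf.prob (iid_pmf n p) {zs. real n * e / 2 \<le> sum_list (map f zs)}"
      using w e n Q(2) by (intro iid_pmf_sum_ge_half) (auto simp: f_def[abs_def])
    also have "\<dots> \<le> measure_pmf.prob (map_pmf (zip xs) (iid_pmf n p)) ?G"
      unfolding measure_map_pmf
    proof (rule measure_pmf.finite_measure_mono_AE, rule AE_pmfI, rule impI)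
      fix ys assume ys: "ys \<in> set_pmf (iid_pmf n p)" "ys \<in> {zs. real n * e / 2 \<le> sum_list (map f zs)}"
      have "length xs = length ys" using xs ys by (simp add: iid_pmf_support(1))
      moreover have "sum_list (map f xs) \<le> 0" using Q(3) by (simp add: f_def[abs_def])
      ultimately have "real n * e / 2 \<le> (\<Sum>(x, y)\<leftarrow>zip xs ys. f y - f x)"
        using z[of ys] ys(2) by simp
      thus "ys \<in> zip xs -` ?G" using Q(1) by (auto simp: f_def intro!: exI[of _ Q])
    qed simp
    finally show "1 / 2 \<le> measure_pmf.prob (map_pmf (zip xs) (iid_pmf n p)) ?G" .
  qed simp
  also have "\<dots> = measure_pmf.prob (iid_pmf n (pair_pmf p p)) ?G" by (simp add: iid_pmf_pair)
  also have "\<dots> \<le> 2 * exp (- real n * e\<^sup>2 / 64)"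
    using w e by (rule symmetrized_chain_deviation)
  finally show ?thesis by simp
qed

section \<open>Thresholds on finite samples\<close>

abbreviation mistakes :: "real \<Rightarrow> point list \<Rightarrow> nat" where
  "mistakes a xs \<equiv> length (filter (\<lambda>p. thr a (fst p) \<noteq> snd p) xs)"

abbreviation disagreements :: "real \<Rightarrow> real \<Rightarrow> point list \<Rightarrow> nat" where
  "disagreements a b xs \<equiv> length (filter (\<lambda>p. thr a (fst p) \<noteq> thr b (fst p)) xs)"

lemma length_filter_le_add:
  assumes "\<And>x. x \<in> set xs \<Longrightarrow> P x \<Longrightarrow> Q x \<or> R x"
  shows "length (filter P xs) \<le> length (filter Q xs) + length (filter R xs)"
  using assms by (induction xs) (force simp: le_SucI)+

lemma length_filter_mono:
  assumes "\<And>x. x \<in> set xs \<Longrightarrow> P x \<Longrightarrow> Q x"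
  shows "length (filter P xs) \<le> length (filter Q xs)"
  using assms by (induction xs) (force simp: le_SucI)+

lemma disagreements_le: "disagreements a b xs \<le> mistakes a xs + mistakes b xs"
  by (rule length_filter_le_add) auto

text \<open>The choice in \<open>erm\<close> is sound because mistake counts are natural numbers: a
  minimum over infinitely many thresholds is attained.\<close>

lemma erm_minimal:
  shows "erm S \<in> {0..1}" and "\<And>b. b \<in> {0..1} \<Longrightarrow> mistakes (erm S) S \<le> mistakes b S"
proof -
  have "\<exists>a. a \<in> {0..1} \<and> (\<forall>b. b \<in> {0..1} \<longrightarrow> mistakes a S \<le> mistakes b S)"
    by (rule ex_has_least_nat[where k = 0]) auto
  then obtain a :: real where a: "a \<in> {0..1}" "\<And>b. b \<in> {0..1} \<Longrightarrow> mistakes a S \<le> mistakes b S"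
    by blast
  have "\<exists>a. a \<in> {0..1} \<and> (\<forall>b\<in>{0..1}. err_S S (thr a) \<le> err_S S (thr b))"
    unfolding err_S_def by (intro exI[of _ a] conjI ballI divide_right_mono) (use a in simp_all)
  hence *: "erm S \<in> {0..1} \<and> (\<forall>b\<in>{0..1}. err_S S (thr (erm S)) \<le> err_S S (thr b))"
    unfolding erm_def by (rule someI_ex)
  thus "erm S \<in> {0..1}" by simp
  fix b :: real assume "b \<in> {0..1}"
  with * have "err_S S (thr (erm S)) \<le> err_S S (thr b)" by blast
  thus "mistakes (erm S) S \<le> mistakes b S"
    by (cases "S = []") (simp_all add: err_S_def divide_le_cancel)
qed

section \<open>Querying from the top until enough negatives are seen\<close>

lemma take_negs_prefix:
  "\<exists>R. xs = take_negs N xs @ R \<and> (R = [] \<or> count_neg (take_negs N xs) = max N 1)"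
proof (induction N xs rule: take_negs.induct)
  case (2 N p ps)
  show ?case
  proof (cases "snd p = -1")
    case True
    show ?thesis
    \<comment> \<open>Budgets 0 and 1 both stop at the first negative, whence
      \<open>max N 1\<close>.\<close>
    proof (cases "N \<le> 1")
      case False
      with 2(1) True obtain R where "ps = take_negs (N - 1) ps @ R"
        "R = [] \<or> count_neg (take_negs (N - 1) ps) = max (N - 1) 1" by blast
      thus ?thesis using True False by (intro exI[of _ R]) (auto simp: count_neg_def)
    qed (use True in \<open>auto simp: count_neg_def\<close>)
  next
    case False
    with 2(2) obtain R where "ps = take_negs N ps @ R"
      "R = [] \<or> count_neg (take_negs N ps) = max N 1" by blast
    thus ?thesis using False by (intro exI[of _ R]) (auto simp: count_neg_def)
  qed
qed (simp add: count_neg_def)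

lemma count_neg_take_negs_le: "count_neg (take_negs N xs) \<le> max N 1"
  by (induction N xs rule: take_negs.induct) (auto simp: count_neg_def)

lemma length_take_negs_le: "length (take_negs N xs) \<le> length xs"
  by (induction N xs rule: take_negs.induct) auto

lemma length_filter_sort_key [simp]: "length (filter P (sort_key f xs)) = length (filter P xs)"
  by (metis mset_filter mset_sort size_mset)

lemma length_filter_rev [simp]: "length (filter P (rev xs)) = length (filter P xs)"
  by (simp flip: rev_filter)

text \<open>Stopping after \<open>N\<close> negatives is harmless: a disagreement below the stopping point would make
  one of the two thresholds err on all \<open>N\<close> queried negatives.\<close>
lemma disagreements_erm_take_negs:
  assumes N: "mistakes a S < N" and a: "a \<in> {0..1}"
  defines "L \<equiv> take_negs N (rev (sort_key fst S))"
  shows "disagreements a (erm L) S \<le> 2 * mistakes a S"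
proof -
  let ?D = "rev (sort_key fst S)"
  obtain R where R: "?D = L @ R" "R = [] \<or> count_neg L = max N 1"
    using take_negs_prefix[of ?D N] unfolding L_def by blast
  have cnt: "length (filter P S) = length (filter P L) + length (filter P R)" for P
    by (metis R(1) length_filter_rev length_filter_sort_key filter_append length_append)
  have erm: "mistakes (erm L) L \<le> mistakes a L" using a by (rule erm_minimal)
  have mL: "mistakes a L \<le> mistakes a S" by (simp add: cnt)
  \<comment> \<open>A threshold not above any queried point predicts +1 on all of them and errs on
    every queried negative.\<close>
  have neg: "count_neg L \<le> mistakes c L" if "\<And>q. q \<in> set L \<Longrightarrow> c \<le> fst q" for c
    unfolding count_neg_def using that by (intro length_filter_mono) (auto simp: thr_def)
  have "filter (\<lambda>p. thr a (fst p) \<noteq> thr (erm L) (fst p)) R = []"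
  proof (rule ccontr)
    assume "filter (\<lambda>p. thr a (fst p) \<noteq> thr (erm L) (fst p)) R \<noteq> []"
    then obtain p where p: "p \<in> set R" "thr a (fst p) \<noteq> thr (erm L) (fst p)"
      by (auto simp: filter_empty_conv)
    have "count_neg L = max N 1" using R(2) p(1) by auto
    hence nL: "mistakes a S < count_neg L" using N by simp
    have "sorted (map fst (sort_key fst S))" by simp
    hence "sorted_wrt (\<lambda>x y. fst y \<le> fst x) ?D" by (simp add: sorted_wrt_rev sorted_wrt_map)
    \<comment> \<open>Queries go downwards, so the unqueried \<open>p\<close> is not above any
      queried point. Whichever of the two thresholds is at most \<open>fst p\<close> errs on all
      queried negatives.\<close>
    hence ge: "fst p \<le> fst q" if "q \<in> set L" for q
      using that p(1) unfolding R(1) by (auto simp: sorted_wrt_append)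
    show False
    proof (cases "a \<le> fst p")
      case True
      have "count_neg L \<le> mistakes a L" using ge True by (intro neg) force
      thus False using nL mL by linarith
    next
      case False
      hence "erm L \<le> fst p" using p(2) by (auto simp: thr_def split: if_splits)
      hence "count_neg L \<le> mistakes (erm L) L" using ge by (intro neg) force
      thus False using nL mL erm by linarith
    qed
  qed
  hence "disagreements a (erm L) S = disagreements a (erm L) L" by (simp add: cnt)
  also have "\<dots> \<le> mistakes a L + mistakes (erm L) L" by (rule disagreements_le)
  finally show ?thesis using erm mL by linarith
qed

section \<open>Blocks and windows in sorted samples\<close>

lemma sorted_nth_less_iff:
  fixes xs :: "real list"
  assumes "sorted xs" "i < length xs"
  shows "xs ! i < a \<longleftrightarrow> i < length (filter (\<lambda>x. x < a) xs)"
  using assms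
proof (induction xs arbitrary: i)
  case (Cons x xs)
  show ?case
  proof (cases "x < a")
    case True
    thus ?thesis using Cons by (cases i) auto
  next
    case False
    have ge: "\<not> y < a" if "y \<in> set (x # xs)" for y using that Cons.prems False by auto
    hence "filter (\<lambda>x. x < a) (x # xs) = []" by (subst filter_empty_conv) blast
    moreover have "\<not> (x # xs) ! i < a" using Cons.prems by (intro ge nth_mem) simp
    ultimately show ?thesis by simp
  qed
qed simp

text \<open>In sorted order the points between two thresholds occupy consecutive positions, and a
  run of \<open>2 * n\<close> positions contains a whole aligned block of length
  \<open>n\<close>.\<close>

lemma full_block_in_disagreement:
  assumes U: "sorted (map fst U)" "length U = T * n" and n: "0 < n"
    and d: "2 * n \<le> disagreements a b U"
  shows "\<exists>t<T. \<forall>p\<in>set (take n (drop (t * n) U)). thr a (fst p) \<noteq> thr b (fst p)"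
  using d
proof (induction a b rule: linorder_wlog)
  case (sym a b)
  have "disagreements b a U = disagreements a b U"
    by (intro arg_cong[of _ _ length] filter_cong) auto
  with sym obtain t where "t < T" "\<forall>p\<in>set (take n (drop (t * n) U)). thr b (fst p) \<noteq> thr a (fst p)"
    by auto
  thus ?case by (intro exI[of _ t] conjI ballI) auto
next
  case (le a b)
  define j where "j c = length (filter (\<lambda>p. fst p < c) U)" for c
  have j: "fst (U ! i) < c \<longleftrightarrow> i < j c" if "i < length U" for i c
    using sorted_nth_less_iff[OF U(1), of i c] that by (simp add: j_def filter_map comp_def)
  have "disagreements a b U + j a = j b"
    unfolding j_def using le(1) by (induction U) (simp_all add: thr_def)
  hence jb: "j a + 2 * n \<le> j b" using le by linarith
  have jl: "j b \<le> T * n" unfolding j_def using U(2) by (metis length_filter_le)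
  \<comment> \<open>The first block starting at or after position \<open>j a\<close>: the quotient
    of \<open>j a\<close> by \<open>n\<close>, rounded up.\<close>
  define t where "t = (j a + n - 1) div n"
  have t: "t * n \<le> j a + n - 1" "j a + n - 1 < t * n + n"
    using n unfolding t_def by (auto simp: div_times_less_eq_dividend dividend_less_div_times add.commute)
  have "t * n + n \<le> T * n" using t jb jl n by linarith
  hence "t < T" using n by (metis add_gr_0 less_le_trans less_add_same_cancel1 mult_less_cancel2)
  moreover have "thr a (fst p) \<noteq> thr b (fst p)" if p: "p \<in> set (take n (drop (t * n) U))" for p
  proof -
    obtain i where i: "i < n" "t * n + i < length U" "p = U ! (t * n + i)"
      using p by (auto simp: in_set_conv_nth)
    have "t * n + i < j b" "\<not> t * n + i < j a" using t i jb n by linarith+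
    thus ?thesis using j[OF i(2), of a] j[OF i(2), of b] i(3) by (simp add: thr_def)
  qed
  ultimately show ?case by blast
qed

text \<open>If \<open>b\<close> disagreed with \<open>a'\<close> at a pool point outside the window around \<open>a\<close>, then each of the
  \<open>r\<close> window points on that side would witness a disagreement of \<open>a\<close> or of \<open>b\<close> with \<open>a'\<close>.\<close>
lemma window_suffices:
  fixes e a :: real and S :: "point list" and r :: nat
  defines "Lt \<equiv> rev (sort_key fst (filter (\<lambda>p. fst p < a) S))"
    and "Rt \<equiv> sort_key fst (filter (\<lambda>p. fst p \<ge> a) S)"
  defines "S1 \<equiv> take r Lt @ take r Rt"
  assumes b: "mistakes b S1 \<le> mistakes a' S1 + e"
    and r: "disagreements a a' S + 2 * mistakes a' S + e < r \<or> length S \<le> r"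
  shows "mistakes b S \<le> mistakes a' S + e"
proof -
  define O1 where "O1 = drop r Lt @ drop r Rt"
  have "mset S = mset Lt + mset Rt"
    using multiset_partition[of "mset S" "\<lambda>p. fst p < a"] by (simp add: Lt_def Rt_def not_less)
  also have "\<dots> = mset (take r Lt @ drop r Lt) + mset (take r Rt @ drop r Rt)" by simp
  also have "\<dots> = mset S1 + mset O1"
    unfolding S1_def O1_def mset_append by (simp only: ac_simps)
  finally have ms: "mset S = mset (S1 @ O1)" by simp
  have cnt: "length (filter P S) = length (filter P S1) + length (filter P O1)" for P
    by (metis ms filter_append length_append mset_filter size_mset)
  have outside: "thr b (fst p) = thr a' (fst p)" if p: "p \<in> set O1" for p
  proof (rule ccontr)
    assume neq: "thr b (fst p) \<noteq> thr a' (fst p)"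
    \<comment> \<open>\<open>X\<close> is the part of the window on the side of \<open>p\<close>,
      between \<open>a\<close> and \<open>p\<close>. If \<open>a\<close>, \<open>a'\<close> and
      \<open>b\<close> agreed at a point of \<open>X\<close>, then \<open>a'\<close> and
      \<open>b\<close> would also agree at \<open>p\<close>, which lies further out.\<close>
    obtain X where X: "length X = r" "\<And>P. length (filter P X) \<le> length (filter P S1)"
      "\<And>q. q \<in> set X \<Longrightarrow> thr a (fst q) \<noteq> thr a' (fst q) \<or> thr b (fst q) \<noteq> thr a' (fst q)"
    proof (cases "p \<in> set (drop r Rt)")
      case True
      have "sorted (map fst Rt)" by (simp add: Rt_def)
      hence "sorted_wrt (\<lambda>x y. fst x \<le> fst y) (take r Rt @ drop r Rt)" by (simp add: sorted_wrt_map)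
      hence le: "fst q \<le> fst p" if "q \<in> set (take r Rt)" for q
        using that True by (auto simp only: sorted_wrt_append)
      have a: "a \<le> fst q" if "q \<in> set (take r Rt)" for q
        using that by (auto simp: Rt_def dest: in_set_takeD)
      show ?thesis
      proof (rule that[of "take r Rt"])
        show "length (take r Rt) = r" using True by (cases "r \<le> length Rt") auto
        show "length (filter P (take r Rt)) \<le> length (filter P S1)" for P by (simp add: S1_def)
        fix q assume q: "q \<in> set (take r Rt)"
        show "thr a (fst q) \<noteq> thr a' (fst q) \<or> thr b (fst q) \<noteq> thr a' (fst q)"
          using le[OF q] a[OF q] neq by (auto simp: thr_def split: if_splits)
      qed
    next
      case False
      hence pL: "p \<in> set (drop r Lt)" using p by (simp add: O1_def)
      have "sorted (map fst (rev Lt))" by (simp add: Lt_def)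
      hence "sorted_wrt (\<lambda>x y. fst y \<le> fst x) (take r Lt @ drop r Lt)"
        by (simp add: sorted_wrt_map sorted_wrt_rev)
      hence le: "fst p \<le> fst q" if "q \<in> set (take r Lt)" for q
        using that pL by (auto simp only: sorted_wrt_append)
      have a: "fst q < a" if "q \<in> set (take r Lt)" for q
        using that by (auto simp: Lt_def dest: in_set_takeD)
      show ?thesis
      proof (rule that[of "take r Lt"])
        show "length (take r Lt) = r" using pL by (cases "r \<le> length Lt") auto
        show "length (filter P (take r Lt)) \<le> length (filter P S1)" for P by (simp add: S1_def)
        fix q assume q: "q \<in> set (take r Lt)"
        show "thr a (fst q) \<noteq> thr a' (fst q) \<or> thr b (fst q) \<noteq> thr a' (fst q)"
          using le[OF q] a[OF q] neq by (auto simp: thr_def split: if_splits)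
      qed
    qed
    have "O1 \<noteq> []" using p by auto
    moreover have "length S1 + length O1 = length S" using cnt[of "\<lambda>_. True"] by simp
    moreover have "r \<le> length S1" using X(1) X(2)[of "\<lambda>_. True"] by simp
    \<comment> \<open>As \<open>p\<close> lies outside the window, the alternative
      \<open>length S \<le> r\<close> is excluded.\<close>
    ultimately have "r < length S" by (cases O1) auto
    have "r = length (filter (\<lambda>_. True) X)" using X(1) by simp
    also have "\<dots> \<le> disagreements a a' X + disagreements b a' X"
      using X(3) by (intro length_filter_le_add) auto
    also have "\<dots> \<le> disagreements a a' S + (mistakes b S1 + mistakes a' S1)"
      using X(2)[of "\<lambda>p. thr a (fst p) \<noteq> thr a' (fst p)"] X(2)[of "\<lambda>p. thr b (fst p) \<noteq> thr a' (fst p)"]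
        cnt[of "\<lambda>p. thr a (fst p) \<noteq> thr a' (fst p)"] disagreements_le[of b a' S1] by linarith
    finally have "real r \<le> real (disagreements a a' S) + real (mistakes b S1) + real (mistakes a' S1)"
      by linarith
    also have "\<dots> \<le> disagreements a a' S + 2 * mistakes a' S + e"
      using b cnt[of "\<lambda>p. thr a' (fst p) \<noteq> snd p"] by simp
    finally show False using r \<open>r < length S\<close> by linarith
  qed
  have "filter (\<lambda>p. thr b (fst p) \<noteq> snd p) O1 = filter (\<lambda>p. thr a' (fst p) \<noteq> snd p) O1"
    using outside by (intro filter_cong) auto
  thus ?thesis using b by (simp add: cnt)
qed

section \<open>Representative subset selection\<close>

lemma set_pmf_unif_list: "xs \<noteq> [] \<Longrightarrow> set_pmf (unif_list xs) = set xs"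
  unfolding unif_list_def by (subst set_map_pmf, subst set_pmf_of_set) (auto simp: set_conv_nth)

lemma prob_unif_list:
  assumes "xs \<noteq> []"
  shows "measure_pmf.prob (unif_list xs) {x. P x} = length (filter P xs) / length xs"
  using assms unfolding unif_list_def
  by (simp add: measure_map_pmf measure_pmf_of_set length_filter_conv_card vimage_def Int_def lessThan_empty_iff)

lemma expectation_unif_list:
  fixes f :: "'a \<Rightarrow> real"
  assumes "xs \<noteq> []"
  shows "measure_pmf.expectation (unif_list xs) f = sum_list (map f xs) / length xs"
  using assms unfolding unif_list_def
  by (simp add: integral_pmf_of_set lessThan_empty_iff sum_list_sum_nth atLeast0LessThan)

text \<open>On a nested family one Chernoff bound is enough: among the regions heavy on
  \<open>S\<close>, a smallest one is contained in all others on \<open>S\<close>, so it is sampled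
  lightly whenever any of them is.\<close>

lemma iid_pmf_chain_mass:
  fixes P :: "'b \<Rightarrow> 'a \<Rightarrow> bool" and u :: real
  assumes S: "S \<noteq> []" and u: "0 < u"
    and chain: "\<And>b b'. b \<in> I \<Longrightarrow> b' \<in> I \<Longrightarrow> (\<forall>x. P b x \<longrightarrow> P b' x) \<or> (\<forall>x. P b' x \<longrightarrow> P b x)"
  shows "measure_pmf.prob (iid_pmf n (unif_list S))
     {xs. \<exists>b\<in>I. 33 * u * length S < length (filter (P b) S) \<and> length (filter (P b) xs) \<le> 14 * u * n}
     \<le> exp (- u * n)"
proof (cases "\<exists>b\<in>I. 33 * u * length S < length (filter (P b) S)")
  case False
  hence "{xs. \<exists>b\<in>I. 33 * u * length S < length (filter (P b) S) \<and> length (filter (P b) xs) \<le> 14 * u * n} = {}"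
    by blast
  thus ?thesis by (simp only: measure_empty exp_ge_zero)
next
  case True
  then obtain b1 where b1: "b1 \<in> I \<and> 33 * u * length S < length (filter (P b1) S)" by blast
  obtain b0 where b0: "b0 \<in> I" "33 * u * length S < length (filter (P b0) S)"
    and least: "\<And>b. b \<in> I \<and> 33 * u * length S < length (filter (P b) S) \<Longrightarrow>
      length (filter (P b0) S) \<le> length (filter (P b) S)"
    using ex_has_least_nat[where P = "\<lambda>b. b \<in> I \<and> 33 * u * length S < length (filter (P b) S)"
        and m = "\<lambda>b. length (filter (P b) S)", OF b1] by blast
  have sub: "P b x" if b: "b \<in> I" "33 * u * length S < length (filter (P b) S)" and x: "x \<in> set S" "P b0 x" for b x
  proof (rule ccontr)
    assume nb: "\<not> P b x"
    hence imp: "\<forall>x. P b x \<longrightarrow> P b0 x" using chain[OF b0(1) b(1)] x(2) by blast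
    have "length (filter (P b) S) = length (filter (P b) (filter (P b0) S))"
      using imp by (intro arg_cong[of _ _ length]) (auto simp: filter_filter intro!: filter_cong)
    also have "\<dots> < length (filter (P b0) S)"
      using x nb by (intro length_filter_less[of x]) auto
    finally show False using least[of b] b by simp
  qed
  have "measure_pmf.prob (iid_pmf n (unif_list S))
     {xs. \<exists>b\<in>I. 33 * u * length S < length (filter (P b) S) \<and> length (filter (P b) xs) \<le> 14 * u * n}
     \<le> measure_pmf.prob (iid_pmf n (unif_list S)) {xs. real (length (filter (P b0) xs)) \<le> real n * (14 * u)}"
  proof (rule measure_pmf.finite_measure_mono_AE, rule AE_pmfI, rule impI)
    fix xs assume xs: "xs \<in> set_pmf (iid_pmf n (unif_list S))"
      "xs \<in> {xs. \<exists>b\<in>I. 33 * u * length S < length (filter (P b) S) \<and> length (filter (P b) xs) \<le> 14 * u * n}"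
    then obtain b where b: "b \<in> I" "33 * u * length S < length (filter (P b) S)" "length (filter (P b) xs) \<le> 14 * u * n"
      by blast
    have "set xs \<subseteq> set S" using iid_pmf_support(2)[OF xs(1)] S by (simp add: set_pmf_unif_list)
    hence "length (filter (P b0) xs) \<le> length (filter (P b) xs)"
      using sub[OF b(1,2)] by (intro length_filter_mono) blast
    thus "xs \<in> {xs. real (length (filter (P b0) xs)) \<le> real n * (14 * u)}"
      using b(3) by (simp add: mult_ac)
  qed simp
  \<comment> \<open>With \<open>l = 1/2\<close> the rate is \<open>7 * u - 33 / 4 * u\<close>, which
    is below \<open>- u\<close>.\<close>
  also have "\<dots> \<le> exp (real n * (1/2 * (14 * u) - (1/2 - (1/2)\<^sup>2) * (33 * u)))"
    using b0(2) S by (intro iid_pmf_count_lower) (simp_all add: prob_unif_list field_simps)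
  also have "\<dots> \<le> exp (- u * n)" using u by (simp add: power2_eq_square field_simps)
  finally show ?thesis .
qed

lemma thr_neq_iff: "thr a x \<noteq> thr b x \<longleftrightarrow> a \<le> x \<and> x < b \<or> b \<le> x \<and> x < a"
  by (auto simp: thr_def)

text \<open>The regions of disagreement with \<open>a\<close> are nested for
  \<open>b \<ge> a\<close> and again for \<open>b \<le> a\<close>, whence the factor 2. The bound
  transfers closeness to \<open>a\<close> from the sample back to the pool.\<close>

lemma iid_pmf_disagreement_mass:
  fixes u :: real
  assumes S: "S \<noteq> []" and u: "0 < u"
  shows "measure_pmf.prob (iid_pmf n (unif_list S))
     {xs. \<exists>b. 33 * u * length S < disagreements a b S \<and> disagreements a b xs \<le> 14 * u * n}
     \<le> 2 * exp (- u * n)"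
proof -
  let ?P = "\<lambda>b p. thr a (fst p) \<noteq> thr b (fst p)"
  let ?E = "\<lambda>I. {xs. \<exists>b\<in>I. 33 * u * length S < disagreements a b S \<and> disagreements a b xs \<le> 14 * u * n}"
  let ?M = "iid_pmf n (unif_list S)"
  have "measure_pmf.prob ?M {xs. \<exists>b. 33 * u * length S < disagreements a b S \<and> disagreements a b xs \<le> 14 * u * n}
     \<le> measure_pmf.prob ?M (?E {a..} \<union> ?E {..a})"
  proof (intro measure_pmf.finite_measure_mono subsetI)
    fix xs assume "xs \<in> {xs. \<exists>b. 33 * u * length S < disagreements a b S \<and> disagreements a b xs \<le> 14 * u * n}"
    then obtain b where "33 * u * length S < disagreements a b S \<and> disagreements a b xs \<le> 14 * u * n" by blast
    thus "xs \<in> ?E {a..} \<union> ?E {..a}" by (cases "a \<le> b") force+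
  qed simp
  also have "\<dots> \<le> measure_pmf.prob ?M (?E {a..}) + measure_pmf.prob ?M (?E {..a})"
    by (intro measure_Un_le) auto
  also have "\<dots> \<le> exp (- u * n) + exp (- u * n)"
    by (intro add_mono iid_pmf_chain_mass S u) (auto simp: thr_neq_iff)
  finally show ?thesis by simp
qed

text \<open>The thresholds on either side of \<open>a\<close> form a chain, so the chain deviation
  is applied twice, at no cost in the number of thresholds.\<close>

lemma iid_pmf_thresholds_deviation:
  fixes W :: "point list" and e :: real
  assumes W: "W \<noteq> []" and e: "0 < e" "e \<le> 1" and n: "16 \<le> real n * e\<^sup>2"
  shows "measure_pmf.prob (iid_pmf n (unif_list W))
     {S. \<exists>b. mistakes a W + e * length W \<le> mistakes b W \<and> mistakes b S \<le> mistakes a S}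
     \<le> 8 * exp (- real n * e\<^sup>2 / 64)"
proof -
  let ?M = "iid_pmf n (unif_list W)"
  \<comment> \<open>The loss of predicting -1 minus that of predicting +1. Raising the threshold
    from \<open>a\<close> to \<open>b\<close> adds \<open>d\<close> on the points in between, and
    lowering it subtracts \<open>d\<close>; this gives \<open>w1\<close> and
    \<open>w2\<close>.\<close>
  define d :: "point \<Rightarrow> real" where "d z = of_bool (-1 \<noteq> snd z) - of_bool (1 \<noteq> snd z)" for z
  define w1 where "w1 z = of_bool (a \<le> fst z) * d z" for z :: point
  define w2 where "w2 z = of_bool (fst z < a) * - d z" for z :: point
  let ?B = "\<lambda>w h. {zs. \<exists>Q. (\<forall>x y. Q x \<longrightarrow> h y \<le> h x \<longrightarrow> Q y) \<and>
        e \<le> measure_pmf.expectation (unif_list W) (\<lambda>z. w z * of_bool (Q z)) \<and>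
        (\<Sum>z\<leftarrow>zs. w z * of_bool (Q z)) \<le> 0}"
  have s1: "(\<Sum>z\<leftarrow>zs. w1 z * of_bool (fst z < b)) = real (mistakes b zs) - real (mistakes a zs)"
    if "a \<le> b" for b zs
    using that by (induction zs) (auto simp: w1_def d_def thr_def)
  have s2: "(\<Sum>z\<leftarrow>zs. w2 z * of_bool (b \<le> fst z)) = real (mistakes b zs) - real (mistakes a zs)"
    if "b \<le> a" for b zs
    using that by (induction zs) (auto simp: w2_def d_def thr_def)
  have "measure_pmf.prob ?M {S. \<exists>b. mistakes a W + e * length W \<le> mistakes b W \<and> mistakes b S \<le> mistakes a S}
    \<le> measure_pmf.prob ?M (?B w1 fst \<union> ?B w2 (\<lambda>z. - fst z))"
  proof (intro measure_pmf.finite_measure_mono subsetI)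
    fix S assume "S \<in> {S. \<exists>b. mistakes a W + e * length W \<le> mistakes b W \<and> mistakes b S \<le> mistakes a S}"
    then obtain b where b: "mistakes a W + e * length W \<le> mistakes b W" "mistakes b S \<le> mistakes a S" by blast
    have ge: "e \<le> (real (mistakes b W) - real (mistakes a W)) / length W"
      using b(1) W by (simp add: field_simps)
    show "S \<in> ?B w1 fst \<union> ?B w2 (\<lambda>z. - fst z)"
    proof (cases "a \<le> b")
      case True
      thus ?thesis using ge b(2) W
        by (intro UnI1 CollectI exI[of _ "\<lambda>z. fst z < b"]) (auto simp: expectation_unif_list s1)
    next
      case False
      thus ?thesis using ge b(2) W
        by (intro UnI2 CollectI exI[of _ "\<lambda>z. b \<le> fst z"]) (auto simp: expectation_unif_list s2)
    qed
  qed simp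
  also have "\<dots> \<le> measure_pmf.prob ?M (?B w1 fst) + measure_pmf.prob ?M (?B w2 (\<lambda>z. - fst z))"
    by (intro measure_Un_le) auto
  also have "\<dots> \<le> 4 * exp (- real n * e\<^sup>2 / 64) + 4 * exp (- real n * e\<^sup>2 / 64)"
    by (intro add_mono iid_pmf_chain_deviation e n) (auto simp: w1_def w2_def d_def)
  finally show ?thesis by simp
qed

section \<open>The blocks of the representative subset\<close>

lemma concat_blocks:
  assumes "T * n \<le> length U"
  shows "concat (map (\<lambda>t. take n (drop (t * n) U)) [0..<T]) = take (T * n) U"
  using assms
proof (induction T)
  case (Suc T)
  have "take (Suc T * n) U = take (T * n) U @ take n (drop (T * n) U)"
    by (simp only: mult_Suc add.commute[of n] take_add)
  thus ?case using Suc by simp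
qed simp

definition rss_blocks :: "real \<Rightarrow> point list \<Rightarrow> point list list" where
  "rss_blocks \<eta>' S = (let T = max (nat \<lfloor>1 / (3 * \<eta>')\<rfloor>) 1; m = length S
     in map (\<lambda>t. take m (drop (t * m) (sort_key fst (concat (replicate T S))))) [0..<T])"

lemma rss_pmf_blocks:
  "rss_pmf \<eta>' \<delta>' S = map_pmf concat
     (seq_pmf (map (\<lambda>B. iid_pmf (nat \<lceil>14 * ln (8 / \<delta>')\<rceil>) (unif_list B)) (rss_blocks \<eta>' S)))"
  by (simp add: rss_pmf_def rss_blocks_def Let_def)

lemma length_concat_replicate: "length (concat (replicate T S)) = T * length S"
  by (induction T) auto

lemma length_filter_concat_replicate:
  "length (filter P (concat (replicate T S))) = T * length (filter P S)"
  by (induction T) auto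

lemma length_filter_concat_ge:
  "xs \<in> set xss \<Longrightarrow> length (filter P xs) \<le> length (filter P (concat xss))"
  by (induction xss) auto

text \<open>The blocks cut the sorted \<open>T\<close>-fold copy of \<open>S\<close> without
  remainder.\<close>

lemma rss_blocks_props:
  fixes \<eta>' :: real
  defines "T \<equiv> max (nat \<lfloor>1 / (3 * \<eta>')\<rfloor>) 1"
  shows "length (rss_blocks \<eta>' S) = T"
    and "\<And>B. B \<in> set (rss_blocks \<eta>' S) \<Longrightarrow> length B = length S"
    and "(\<Sum>B\<leftarrow>rss_blocks \<eta>' S. length (filter P B)) = T * length (filter P S)"
proof -
  define U where "U = sort_key fst (concat (replicate T S))"
  have lU: "length U = T * length S" by (simp add: U_def length_concat_replicate)
  have bl: "rss_blocks \<eta>' S = map (\<lambda>t. take (length S) (drop (t * length S) U)) [0..<T]"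
    by (simp add: rss_blocks_def Let_def U_def T_def)
  show "length (rss_blocks \<eta>' S) = T" by (simp add: bl)
  show "length B = length S" if B: "B \<in> set (rss_blocks \<eta>' S)" for B
  proof -
    obtain t where t: "t < T" "B = take (length S) (drop (t * length S) U)" using B by (auto simp: bl)
    have "Suc t * length S \<le> T * length S" using t(1) by (intro mult_right_mono) auto
    thus ?thesis using t(2) lU by simp
  qed
  have "(\<Sum>B\<leftarrow>rss_blocks \<eta>' S. length (filter P B)) = length (filter P (concat (rss_blocks \<eta>' S)))"
    by (induction "rss_blocks \<eta>' S" rule: rev_induct) (simp_all add: filter_concat length_concat comp_def)
  also have "concat (rss_blocks \<eta>' S) = U" using lU by (simp add: bl concat_blocks)
  also have "length (filter P U) = T * length (filter P S)" by (simp add: U_def length_filter_concat_replicate)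
  finally show "(\<Sum>B\<leftarrow>rss_blocks \<eta>' S. length (filter P B)) = T * length (filter P S)" .
qed

lemma rss_pmf_length:
  assumes "Q \<in> set_pmf (rss_pmf \<eta>' \<delta>' S)"
  shows "length Q = max (nat \<lfloor>1 / (3 * \<eta>')\<rfloor>) 1 * nat \<lceil>14 * ln (8 / \<delta>')\<rceil>"
proof -
  define k where "k = nat \<lceil>14 * ln (8 / \<delta>')\<rceil>"
  obtain xss where xss: "Q = concat xss"
    "list_all2 (\<lambda>xs p. xs \<in> set_pmf p) xss (map (\<lambda>B. iid_pmf k (unif_list B)) (rss_blocks \<eta>' S))"
    using assms unfolding rss_pmf_blocks k_def[symmetric] by (auto dest: seq_pmf_support)
  have "list_all2 (\<lambda>xs B. length xs = k) xss (rss_blocks \<eta>' S)"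
    using xss(2) unfolding list_all2_map2 by (rule list_all2_mono) (auto dest: iid_pmf_support)
  hence "length (concat xss) = length (rss_blocks \<eta>' S) * k"
    by (induction rule: list_all2_induct) auto
  thus ?thesis by (simp add: xss(1) rss_blocks_props(1) k_def)
qed

text \<open>Otherwise a whole block would lie between the two thresholds, and all draws from it
  would be disagreements. This holds for every possible \<open>Q\<close>, not just with high
  probability.\<close>

lemma rss_pmf_disagreements:
  assumes S: "S \<noteq> []" and Q: "Q \<in> set_pmf (rss_pmf \<eta>' \<delta>' S)"
    and d: "disagreements a b Q < nat \<lceil>14 * ln (8 / \<delta>')\<rceil>"
  defines "T \<equiv> max (nat \<lfloor>1 / (3 * \<eta>')\<rfloor>) 1"
  shows "T * disagreements a b S < 2 * length S"
proof (rule ccontr)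
  assume neg: "\<not> T * disagreements a b S < 2 * length S"
  define k where "k = nat \<lceil>14 * ln (8 / \<delta>')\<rceil>"
  let ?P = "\<lambda>p. thr a (fst p) \<noteq> thr b (fst p)"
  define U where "U = sort_key fst (concat (replicate T S))"
  have bl: "rss_blocks \<eta>' S = map (\<lambda>t. take (length S) (drop (t * length S) U)) [0..<T]"
    by (simp add: rss_blocks_def Let_def U_def T_def)
  have *: "\<exists>t<T. \<forall>p\<in>set (take (length S) (drop (t * length S) U)). ?P p"
    using neg S by (intro full_block_in_disagreement)
      (auto simp: U_def length_concat_replicate length_filter_concat_replicate)
  obtain B where B: "B \<in> set (rss_blocks \<eta>' S)" "\<forall>p\<in>set B. ?P p"
  proof -
    from * obtain t where "t < T" "\<forall>p\<in>set (take (length S) (drop (t * length S) U)). ?P p" by blast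
    thus thesis by (intro that[of "take (length S) (drop (t * length S) U)"]) (auto simp: bl)
  qed
  obtain xss where xss: "Q = concat xss"
    "list_all2 (\<lambda>xs p. xs \<in> set_pmf p) xss (map (\<lambda>B. iid_pmf k (unif_list B)) (rss_blocks \<eta>' S))"
    using Q unfolding rss_pmf_blocks k_def[symmetric] by (auto dest: seq_pmf_support)
  from B(1) obtain i where i: "i < length (rss_blocks \<eta>' S)" "rss_blocks \<eta>' S ! i = B"
    by (auto simp: in_set_conv_nth)
  have "xss ! i \<in> set_pmf (iid_pmf k (unif_list B))" "i < length xss"
    using xss(2) i by (auto simp: list_all2_conv_all_nth)
  moreover have "B \<noteq> []" using rss_blocks_props(2)[OF B(1)] S by auto
  ultimately have xs: "xss ! i \<in> set xss" "length (xss ! i) = k" "set (xss ! i) \<subseteq> set B"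
    using iid_pmf_support[of "xss ! i" k "unif_list B"] by (auto simp: set_pmf_unif_list)
  have "k = length (filter ?P (xss ! i))"
  proof -
    have "filter ?P (xss ! i) = xss ! i" using xs(3) B(2) by (intro filter_True) auto
    thus ?thesis using xs(2) by simp
  qed
  also have "\<dots> \<le> length (filter ?P (concat xss))"
    using xs(1) by (rule length_filter_concat_ge)
  finally show False using d unfolding xss(1) k_def[symmetric] by linarith
qed

text \<open>The blocks differ, so the moment of \<open>2 ^ mistakes a Q\<close> is a product over
  blocks. It is at most \<open>exp (k / 4)\<close>, because the mistake rates of the blocks sum to
  at most \<open>1 / 4\<close>.\<close>

lemma rss_pmf_mistakes:
  fixes \<eta>' \<delta>' :: real
  assumes S: "S \<noteq> []"
  defines "T \<equiv> max (nat \<lfloor>1 / (3 * \<eta>')\<rfloor>) 1" and "k \<equiv> nat \<lceil>14 * ln (8 / \<delta>')\<rceil>"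
  assumes m: "4 * (T * mistakes a S) \<le> length S"
  shows "measure_pmf.prob (rss_pmf \<eta>' \<delta>' S) {Q. k \<le> 2 * mistakes a Q} \<le> exp (- real k / 12)"
proof -
  let ?P = "\<lambda>p. thr a (fst p) \<noteq> snd p"
  define g :: "point \<Rightarrow> ennreal" where "g p = (if ?P p then 2 else 1)" for p
  let ?q = "seq_pmf (map (\<lambda>B. iid_pmf k (unif_list B)) (rss_blocks \<eta>' S))"
  have g: "prod_list (map g xs) = 2 ^ mistakes a xs" for xs
    by (induction xs) (auto simp: g_def)
  have gg: "2 ^ mistakes a (concat xss) = prod_list (map (\<lambda>xs. prod_list (map g xs)) xss)" for xss
    by (induction xss) (auto simp: g power_add)
  have gB: "(\<integral>\<^sup>+p. g p \<partial>measure_pmf (unif_list B)) \<le> ennreal (exp (real (mistakes a B) / real (length S)))"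
    if B: "B \<in> set (rss_blocks \<eta>' S)" for B
  proof -
    have lB: "length B = length S" using rss_blocks_props(2)[OF B] .
    hence "B \<noteq> []" using S by auto
    have "(\<integral>\<^sup>+p. g p \<partial>measure_pmf (unif_list B)) = (\<integral>\<^sup>+p. 1 + indicator {p. ?P p} p \<partial>measure_pmf (unif_list B))"
      by (intro nn_integral_cong) (auto simp: g_def one_add_one split: split_indicator)
    also have "\<dots> = ennreal (1 + real (mistakes a B) / real (length S))"
      using \<open>B \<noteq> []\<close> lB by (simp add: nn_integral_add measure_pmf.emeasure_eq_measure prob_unif_list)
    also have "\<dots> \<le> ennreal (exp (real (mistakes a B) / real (length S)))"
      by (intro ennreal_leI exp_ge_add_one_self)
    finally show ?thesis .
  qed
  have gen: "prod_list (map (\<lambda>B. (\<integral>\<^sup>+p. g p \<partial>measure_pmf (unif_list B)) ^ k) Bs) \<le> ennreal (exp (real k / real (length S) * (\<Sum>B\<leftarrow>Bs. mistakes a B)))"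
    if "\<And>B. B \<in> set Bs \<Longrightarrow> (\<integral>\<^sup>+p. g p \<partial>measure_pmf (unif_list B)) \<le> ennreal (exp (real (mistakes a B) / real (length S)))" for Bs
    using that
  proof (induction Bs)
    case (Cons B Bs)
    have "(\<integral>\<^sup>+p. g p \<partial>measure_pmf (unif_list B)) ^ k \<le> ennreal (exp (real (mistakes a B) / real (length S))) ^ k"
      using Cons.prems by (intro power_mono) auto
    also have "\<dots> = ennreal (exp (real k / real (length S) * mistakes a B))"
      by (simp add: ennreal_power exp_of_nat_mult[symmetric])
    finally have "(\<integral>\<^sup>+p. g p \<partial>measure_pmf (unif_list B)) ^ k * prod_list (map (\<lambda>B. (\<integral>\<^sup>+p. g p \<partial>measure_pmf (unif_list B)) ^ k) Bs) \<le>
       ennreal (exp (real k / real (length S) * mistakes a B)) * ennreal (exp (real k / real (length S) * (\<Sum>B\<leftarrow>Bs. mistakes a B)))"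
      using Cons by (intro mult_mono) auto
    thus ?case by (simp add: ennreal_mult[symmetric] exp_add[symmetric] algebra_simps)
  qed simp
  have "(\<integral>\<^sup>+xss. 2 ^ mistakes a (concat xss) \<partial>measure_pmf ?q) =
      prod_list (map (\<lambda>B. (\<integral>\<^sup>+p. g p \<partial>measure_pmf (unif_list B)) ^ k) (rss_blocks \<eta>' S))"
    by (simp add: gg nn_integral_seq_pmf nn_integral_iid_pmf comp_def)
  also have "\<dots> \<le> ennreal (exp (real k / real (length S) * (\<Sum>B\<leftarrow>rss_blocks \<eta>' S. mistakes a B)))"
    by (intro gen gB)
  also have "\<dots> \<le> ennreal (exp (real k / 4))"
  proof -
    have "4 * real (T * mistakes a S) \<le> length S" using m by linarith
    hence "real k * (4 * real (T * mistakes a S)) \<le> real k * length S" by (rule mult_left_mono) simp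
    thus ?thesis using S unfolding rss_blocks_props(3) T_def[symmetric]
      by (intro ennreal_leI) (simp add: field_simps)
  qed
  finally have int: "(\<integral>\<^sup>+xss. 2 ^ mistakes a (concat xss) \<partial>measure_pmf ?q) \<le> ennreal (exp (real k / 4))" .
  \<comment> \<open>At \<open>k / 2\<close> mistakes the variable is at least
    \<open>exp (k / 3)\<close>, since \<open>ln 2 \<ge> 2 / 3\<close>; Markov's inequality leaves
    \<open>exp (k / 4 - k / 3)\<close>.\<close>
  have sub: "1 \<le> ennreal (exp (- real k / 3)) * 2 ^ j" if "k \<le> 2 * j" for j :: nat
  proof -
    have "real k / 3 \<le> real j * (2 / 3)" using that by linarith
    also have "\<dots> \<le> real j * ln 2" using ln2_ge_two_thirds by (intro mult_left_mono) auto
    finally have "1 \<le> exp (- real k / 3 + real j * ln 2)" by simp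
    also have "\<dots> = exp (- real k / 3) * 2 ^ j" by (subst exp_add) (simp add: exp_of_nat_mult)
    finally have "ennreal 1 \<le> ennreal (exp (- real k / 3) * 2 ^ j)" by (rule ennreal_leI)
    thus ?thesis by (simp add: ennreal_mult ennreal_power[symmetric])
  qed
  have "emeasure (rss_pmf \<eta>' \<delta>' S) {Q. k \<le> 2 * mistakes a Q} = emeasure ?q {xss. k \<le> 2 * mistakes a (concat xss)}"
    by (simp add: rss_pmf_blocks k_def vimage_def)
  also have "\<dots> \<le> emeasure ?q {xss\<in>UNIV. 1 \<le> ennreal (exp (- real k / 3)) * 2 ^ mistakes a (concat xss)}"
    using sub by (intro emeasure_mono) auto
  also have "\<dots> \<le> ennreal (exp (- real k / 3)) * (\<integral>\<^sup>+xss. 2 ^ mistakes a (concat xss) * indicator UNIV xss \<partial>measure_pmf ?q)"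
    by (rule nn_integral_Markov_inequality) auto
  also have "\<dots> \<le> ennreal (exp (- real k / 3)) * ennreal (exp (real k / 4))"
    using int by (intro mult_left_mono) auto
  also have "\<dots> = ennreal (exp (- real k / 12))"
    by (simp add: ennreal_mult[symmetric] exp_add[symmetric])
  finally show ?thesis by (simp add: measure_pmf.emeasure_eq_measure)
qed

text \<open>Here \<open>u\<close> plays the role of \<open>(1 + \<nu>) * \<eta>\<close>. The only
  random failure is that \<open>a\<close> errs on at least \<open>k / 2\<close> drawn points;
  outside it the argument is deterministic.\<close>

lemma rss_pmf_erm_close:
  fixes u \<delta> :: real
  assumes S: "S \<noteq> []" and u: "0 < u" "36 * u < 1" and \<delta>: "0 < \<delta>" "\<delta> < 1" and a: "a \<in> {0..1}"
    and m: "mistakes a S \<le> 3 / 2 * u * length S"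
  shows "measure_pmf.prob (rss_pmf (2 * u) (\<delta> / 2) S)
    {Q. 14 * u * length S <
      disagreements a (erm (take_negs (nat \<lceil>12 * real (length Q) * u\<rceil> + 1) (rev (sort_key fst Q)))) S}
    \<le> \<delta> / 16"
proof -
  define k where "k = nat \<lceil>14 * ln (8 / (\<delta> / 2))\<rceil>"
  define T where "T = max (nat \<lfloor>1 / (3 * (2 * u))\<rfloor>) 1"
  define x where "x = 1 / (3 * (2 * u))"
  \<comment> \<open>With \<open>T\<close> at least 6, rounding down costs little:
    \<open>6 * u * T \<le> 1 < 7 * u * T\<close>.\<close>
  have "6 < x" using u by (simp add: x_def field_simps)
  hence Tx: "real T \<le> x" "x < real T + 1" "6 \<le> T"
    unfolding T_def x_def[symmetric] by linarith+
  have xu: "x * (6 * u) = 1" using u by (simp add: x_def)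
  have T1: "6 * u * T \<le> 1" using mult_right_mono[OF Tx(1), of "6 * u"] u unfolding xu by (simp add: mult_ac)
  have "1 < (real T + 1) * (6 * u)" using mult_strict_right_mono[OF Tx(2), of "6 * u"] u xu by simp
  also have "\<dots> \<le> 7 * u * T"
    using mult_left_mono[of 6 "real T" u] Tx(3) u by (simp add: algebra_simps)
  finally have T2: "1 < 7 * u * T" .
  have "4 * real (T * mistakes a S) \<le> 4 * (real T * (3 / 2 * u * length S))"
    unfolding of_nat_mult using m by (intro mult_left_mono) auto
  also have "\<dots> = 6 * u * T * length S" by simp
  also have "\<dots> \<le> 1 * real (length S)" using T1 by (intro mult_right_mono) auto
  finally have m4: "4 * (T * mistakes a S) \<le> length S" by linarith
  have "measure_pmf.prob (rss_pmf (2 * u) (\<delta> / 2) S)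
    {Q. 14 * u * length S <
      disagreements a (erm (take_negs (nat \<lceil>12 * real (length Q) * u\<rceil> + 1) (rev (sort_key fst Q)))) S}
    \<le> measure_pmf.prob (rss_pmf (2 * u) (\<delta> / 2) S) {Q. k \<le> 2 * mistakes a Q}"
  proof (rule measure_pmf.finite_measure_mono_AE, rule AE_pmfI, rule impI)
    fix Q
    define L where "L = take_negs (nat \<lceil>12 * real (length Q) * u\<rceil> + 1) (rev (sort_key fst Q))"
    assume Q: "Q \<in> set_pmf (rss_pmf (2 * u) (\<delta> / 2) S)"
      "Q \<in> {Q. 14 * u * length S <
      disagreements a (erm (take_negs (nat \<lceil>12 * real (length Q) * u\<rceil> + 1) (rev (sort_key fst Q)))) S}"
    hence far: "14 * u * length S < disagreements a (erm L) S" by (simp add: L_def)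
    show "Q \<in> {Q. k \<le> 2 * mistakes a Q}"
    proof (rule ccontr)
      assume "Q \<notin> {Q. k \<le> 2 * mistakes a Q}"
      hence E: "2 * mistakes a Q < k" by simp
      have lQ: "length Q = T * k" unfolding T_def k_def by (rule rss_pmf_length[OF Q(1)])
      \<comment> \<open>The stopping count exceeds \<open>k\<close>, hence also the number of
        mistakes of \<open>a\<close>.\<close>
      have "real k \<le> (12 * u * T) * k"
        using T2 u mult_right_mono[of 1 "12 * u * T" "real k"] by simp
      also have "\<dots> = 12 * real (length Q) * u" by (simp add: lQ)
      finally have "mistakes a Q < nat \<lceil>12 * real (length Q) * u\<rceil> + 1" using E by linarith
      hence "disagreements a (erm L) Q \<le> 2 * mistakes a Q"
        unfolding L_def using a by (rule disagreements_erm_take_negs)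
      hence "disagreements a (erm L) Q < k" using E by linarith
      hence "T * disagreements a (erm L) S < 2 * length S"
        unfolding T_def k_def by (rule rss_pmf_disagreements[OF S Q(1)])
      hence "real T * disagreements a (erm L) S \<le> 2 * length S"
        unfolding of_nat_mult[symmetric] by linarith
      \<comment> \<open>Multiplying by \<open>7 * u\<close> turns the block bound into
        \<open>14 * u * length S\<close>.\<close>
      hence "7 * u * (real T * disagreements a (erm L) S) \<le> 7 * u * (2 * length S)"
        using u by (intro mult_left_mono) auto
      moreover have "1 * real (disagreements a (erm L) S) \<le> 7 * u * T * disagreements a (erm L) S"
        using T2 by (intro mult_right_mono) auto
      ultimately show False using far by (simp add: mult_ac)
    qed
  qed simp
  also have "\<dots> \<le> exp (- real k / 12)"
    unfolding k_def using S m4 unfolding T_def by (rule rss_pmf_mistakes)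
  also have "\<dots> \<le> exp (- ln (8 / (\<delta> / 2)))"
  proof -
    \<comment> \<open>The factor 14 in \<open>k\<close> outweighs the division by 12 in the
      exponent.\<close>
    have "14 * ln (8 / (\<delta> / 2)) \<le> real k" unfolding k_def by linarith
    moreover have "0 \<le> ln (8 / (\<delta> / 2))" using \<delta> by (simp add: field_simps)
    ultimately show ?thesis by simp
  qed
  also have "\<dots> = \<delta> / 16" using \<delta> by (simp add: exp_minus)
  finally show ?thesis .
qed

section \<open>The algorithm on a fixed good pool\<close>

lemma disagreements_commute: "disagreements a b xs = disagreements b a xs"
  by (intro arg_cong[of _ _ length] filter_cong) auto

text \<open>Failures of the subsample, the representative subset and the final sample are charged
  \<open>\<delta> / 8\<close>, \<open>\<delta> / 16\<close> and \<open>\<delta> / 8\<close>. The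
  predicate \<open>G\<close> abstracts what the pool guarantees for thresholds of small pool
  error.\<close>

lemma audit_thr_good_pool:
  fixes \<eta> \<delta> \<alpha> C c a :: real
  assumes C: "1000000 \<le> C" "100 \<le> c"
    and \<eta>: "0 < \<eta>" "\<eta> < 1" and \<delta>: "0 < \<delta>" "\<delta> < 1" and \<alpha>: "0 < \<alpha>" "\<alpha> < 1" and a: "a \<in> {0..1}"
    and S0: "1 \<le> \<eta> * length S0" "mistakes a S0 \<le> (1 + \<alpha> / 20) * \<eta> * length S0"
    and G: "\<And>b. b \<in> {0..1} \<Longrightarrow> mistakes b S0 \<le> (1 + 2 * (\<alpha> / 5)) * \<eta> * length S0 \<Longrightarrow> G b"
  shows "measure_pmf.prob (audit_thr C c \<eta> \<delta> \<alpha> S0) {r. \<not> G (fst r)} \<le> \<delta> / 2"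
proof -
  define \<nu> where "\<nu> = \<alpha> / 5"
  define u where "u = (1 + \<nu>) * \<eta>"
  define A where "A = 1 + ln (c / (\<delta> / 2))"
  define n where "n = nat \<lceil>m_ag C c u (\<delta> / 2) 1\<rceil>"
  define n2 where "n2 = nat \<lceil>m_ag C c (\<nu> / 72) (\<delta> / 2) 1\<rceil>"
  define r where "r = nat \<lceil>36 * u * real (length S0)\<rceil>"
  define m where "m = real (length S0)"
  define hat where "hat Q = erm (take_negs (nat \<lceil>12 * real (length Q) * u\<rceil> + 1) (rev (sort_key fst Q)))" for Q :: "point list"
  define neg where "neg Q = count_neg (take_negs (nat \<lceil>12 * real (length Q) * u\<rceil> + 1) (rev (sort_key fst Q)))" for Q :: "point list"
  define S1 where "S1 b = take r (rev (sort_key fst (filter (\<lambda>p. fst p < b) S0)))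
                    @ take r (sort_key fst (filter (\<lambda>p. fst p \<ge> b) S0))" for b
  have \<nu>: "0 < \<nu>" "\<nu> < 1 / 5" using \<alpha> by (auto simp: \<nu>_def)
  have u: "0 < u" "u \<le> 6 / 5" "\<eta> \<le> u" "u \<le> 6 / 5 * \<eta>"
  proof -
    show "0 < u" "\<eta> \<le> u" using \<nu> \<eta> by (auto simp: u_def)
    show "u \<le> 6 / 5 * \<eta>" unfolding u_def using \<nu> \<eta> by (intro mult_right_mono) auto
    thus "u \<le> 6 / 5" using \<eta> by simp
  qed
  have um: "\<eta> * m \<le> u * m" "u * m \<le> 6 / 5 * (\<eta> * m)" "1 \<le> \<eta> * m"
    using u S0(1) mult_right_mono[of u "6 / 5 * \<eta>" m] by (auto simp: m_def mult_right_mono)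
  have S0ne: "S0 \<noteq> []" using S0(1) by auto
  have c\<delta>: "200 / \<delta> \<le> c / (\<delta> / 2)" "0 < c / (\<delta> / 2)" "1 \<le> c / (\<delta> / 2)"
    using C \<delta> by (auto simp: field_simps)
  have A: "1 \<le> A" unfolding A_def using ln_ge_zero[OF c\<delta>(3)] by linarith
  have tail: "exp (- x) \<le> \<delta> / 200" if "A \<le> x" for x
  proof -
    have "exp (- x) \<le> exp (- ln (c / (\<delta> / 2)))" using that unfolding A_def exp_le_cancel_iff by linarith
    also have "\<dots> = 1 / (c / (\<delta> / 2))" unfolding exp_minus exp_ln[OF c\<delta>(2)] by (rule inverse_eq_divide)
    also have "\<dots> \<le> 1 / (200 / \<delta>)" using c\<delta> \<delta> by (intro divide_left_mono mult_pos_pos) auto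
    finally show ?thesis by simp
  qed
  have n: "16 * A \<le> u * n" "0 < n"
  proof -
    have "1000000 * A \<le> C * A" using C A by (intro mult_right_mono) auto
    hence "16 * A \<le> C * A / (6 / 5)" using A by simp
    also have "\<dots> \<le> C * A / u" using u C A by (intro divide_left_mono) auto
    also have "\<dots> = u * (C * A / u\<^sup>2)" using u by (simp add: power2_eq_square)
    also have "\<dots> \<le> u * n"
      using u unfolding n_def m_ag_def A_def by (intro mult_left_mono) linarith+
    finally show *: "16 * A \<le> u * n" .
    show "0 < n" using * A u by (cases "n = 0") auto
  qed
  \<comment> \<open>The window has at most \<open>74 * u * m\<close> points, so an error rate of
    \<open>\<nu> / 100\<close> on it amounts to at most \<open>9 / 10 * \<nu> * \<eta> * m\<close>
    pool mistakes.\<close>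
  define e where "e = \<nu> / 100"
  have e: "0 < e" "e \<le> 1" using \<nu> by (auto simp: e_def)
  have n2: "64 * A \<le> n2 * e\<^sup>2"
  proof -
    have "1000000 * A \<le> C * A" using C A by (intro mult_right_mono) auto
    hence "64 * A \<le> C * A * (5184 / 10000)" using A by linarith
    also have "\<dots> = C * A / (\<nu> / 72)\<^sup>2 * e\<^sup>2"
      using \<nu> by (simp add: e_def power2_eq_square)
    also have "\<dots> \<le> n2 * e\<^sup>2"
      unfolding n2_def m_ag_def A_def by (intro mult_right_mono) (linarith, simp)
    finally show ?thesis .
  qed
  have mis: "mistakes a S0 \<le> (1 + \<nu> / 4) * \<eta> * m" using S0(2) by (simp add: \<nu>_def m_def)
  have r: "36 * (u * m) \<le> r" "r \<le> 36 * (u * m) + 1"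
    using u um unfolding r_def m_def by (auto simp: mult.assoc)
  \<comment> \<open>A subsample is bad if \<open>a\<close> errs too often on it, or if some
    threshold far from \<open>a\<close> on the pool looks close on it.\<close>
  define bad where "bad = {S. real n * (3 / 2 * u) \<le> real (mistakes a S)} \<union>
    {S. \<exists>b. 33 * u * length S0 < disagreements a b S0 \<and> disagreements a b S \<le> 14 * u * n}"
  have P1: "measure_pmf.prob (iid_pmf n (unif_list S0)) bad \<le> \<delta> / 8"
  proof -
    have "mistakes a S0 / length S0 \<le> (1 + \<nu> / 4) * \<eta>"
      using mis S0ne by (simp add: m_def field_simps)
    also have "\<dots> \<le> u" unfolding u_def using \<nu> \<eta> by (intro mult_right_mono) auto
    finally have "measure_pmf.prob (iid_pmf n (unif_list S0)) {S. real n * (3 / 2 * u) \<le> real (mistakes a S)}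
      \<le> exp (real n * ((1/4 + (1/4)\<^sup>2) * u - 1/4 * (3 / 2 * u)))"
      using S0ne by (intro iid_pmf_count_upper) (auto simp: prob_unif_list)
    \<comment> \<open>The choice \<open>l = 1/4\<close> gives the rate
      \<open>(5 / 16 - 6 / 16) * u\<close>.\<close>
    also have "\<dots> = exp (- (u * n / 16))" by (simp add: power2_eq_square field_simps)
    also have "\<dots> \<le> \<delta> / 200" using n by (intro tail) auto
    finally have 1: "measure_pmf.prob (iid_pmf n (unif_list S0)) {S. real n * (3 / 2 * u) \<le> real (mistakes a S)} \<le> \<delta> / 200" .
    have "measure_pmf.prob (iid_pmf n (unif_list S0))
      {S. \<exists>b. 33 * u * length S0 < disagreements a b S0 \<and> disagreements a b S \<le> 14 * u * n} \<le> 2 * exp (- u * n)"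
      using S0ne u by (intro iid_pmf_disagreement_mass)
    also have "\<dots> \<le> 2 * (\<delta> / 200)" using n A tail[of "u * n"] by simp
    finally have 2: "measure_pmf.prob (iid_pmf n (unif_list S0))
      {S. \<exists>b. 33 * u * length S0 < disagreements a b S0 \<and> disagreements a b S \<le> 14 * u * n} \<le> 2 * (\<delta> / 200)" .
    have "measure_pmf.prob (iid_pmf n (unif_list S0)) bad \<le> \<delta> / 200 + 2 * (\<delta> / 200)"
      unfolding bad_def by (rule order_trans[OF measure_Un_le add_mono[OF 1 2]]) auto
    thus ?thesis using \<delta> by simp
  qed
  have stage3: "measure_pmf.prob (bind_pmf (iid_pmf n2 (unif_list (S1 (hat Q))))
      (\<lambda>S2. return_pmf (erm S2, neg Q + count_neg S2))) {r. \<not> G (fst r)} \<le> \<delta> / 8"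
    \<comment> \<open>For \<open>36 * u \<ge> 1\<close> the window is the whole pool, so closeness
      of the first estimate is asked for only in the other case.\<close>
    if d: "36 * u < 1 \<Longrightarrow> disagreements a (hat Q) S0 \<le> 33 * u * m" for Q
  proof -
    define W where "W = S1 (hat Q)"
    have r1: "1 \<le> r" using r um by linarith
    have lW: "real (length W) \<le> 74 * (u * m)"
    proof -
      have "length W \<le> 2 * r" by (simp add: W_def S1_def)
      thus ?thesis using r um by linarith
    qed
    have Wne: "W \<noteq> []"
    proof -
      have "hd S0 \<in> set S0" using S0ne by simp
      hence "filter (\<lambda>p. fst p < hat Q) S0 \<noteq> [] \<or> filter (\<lambda>p. fst p \<ge> hat Q) S0 \<noteq> []"
        by (metis (mono_tags, lifting) filter_empty_conv not_le)
      hence "0 < length (filter (\<lambda>p. fst p < hat Q) S0) \<or> 0 < length (filter (\<lambda>p. fst p \<ge> hat Q) S0)"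
        by simp
      moreover have "length W = min (length (filter (\<lambda>p. fst p < hat Q) S0)) r +
          min (length (filter (\<lambda>p. fst p \<ge> hat Q) S0)) r"
        by (simp add: W_def S1_def)
      ultimately have "0 < length W" using r1 by linarith
      thus ?thesis by simp
    qed
    have \<nu>m: "\<nu> * (\<eta> * m) \<le> 1 / 5 * (\<eta> * m)" "0 < \<nu> * (\<eta> * m)"
      using \<nu> um mult_right_mono[of \<nu> "1 / 5" "\<eta> * m"] mult_pos_pos[of \<nu> "\<eta> * m"] by linarith+
    have eW: "e * length W \<le> 9 / 10 * (\<nu> * (\<eta> * m))"
    proof -
      have "e * length W \<le> e * (74 * (6 / 5 * (\<eta> * m)))"
        using lW um e by (intro mult_left_mono) auto
      also have "\<dots> = 111 / 125 * (\<nu> * (\<eta> * m))" by (simp add: e_def)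
      also have "\<dots> \<le> 9 / 10 * (\<nu> * (\<eta> * m))" using \<nu>m by (intro mult_right_mono) auto
      finally show ?thesis .
    qed
    let ?bad = "{S. \<exists>b. mistakes a W + e * length W \<le> mistakes b W \<and> mistakes b S \<le> mistakes a S}"
    have good: "G (erm S2)" if S2: "S2 \<notin> ?bad" for S2
    proof (rule G)
      show "erm S2 \<in> {0..1}" by (rule erm_minimal)
      have "mistakes (erm S2) S2 \<le> mistakes a S2" using a by (rule erm_minimal)
      hence "mistakes (erm S2) W < mistakes a W + e * length W" using S2 by force
      hence lt: "mistakes (erm S2) W \<le> mistakes a W + e * length W" by simp
      have "length S0 \<le> r" if "\<not> 36 * u < 1"
      proof -
        have "1 * m \<le> 36 * u * m" using that by (intro mult_right_mono) (auto simp: m_def)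
        thus ?thesis using r by (simp add: m_def)
      qed
      \<comment> \<open>The gap between 33 and 36 pays for the rest: twice the mistakes of
        \<open>a\<close> plus the window slack stay below \<open>3 * u * m\<close>.\<close>
      moreover have "disagreements (hat Q) a S0 + 2 * mistakes a S0 + e * length W < r" if "36 * u < 1"
      proof -
        have "2 * real (mistakes a S0) \<le> 2 * (\<eta> * m) + 1 / 2 * (\<nu> * (\<eta> * m))"
          using mis by (simp add: algebra_simps)
        moreover have "real (disagreements (hat Q) a S0) \<le> 33 * (u * m)"
          using d[OF that] by (simp add: disagreements_commute[of "hat Q"])
        ultimately show ?thesis using eW \<nu>m um r by simp
      qed
      ultimately have "disagreements (hat Q) a S0 + 2 * mistakes a S0 + e * length W < r \<or> length S0 \<le> r"
        by blast
      with lt have "mistakes (erm S2) S0 \<le> mistakes a S0 + e * length W"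
        using window_suffices[where a = "hat Q" and S = S0 and r = r and b = "erm S2" and a' = a
            and e = "e * length W", folded S1_def, folded W_def] by blast
      also have "\<dots> \<le> (1 + \<nu> / 4) * \<eta> * m + 9 / 10 * (\<nu> * (\<eta> * m))" using mis eW by linarith
      also have "\<dots> \<le> (1 + 2 * \<nu>) * \<eta> * m" using \<nu>m by (simp add: algebra_simps)
      finally show "mistakes (erm S2) S0 \<le> (1 + 2 * (\<alpha> / 5)) * \<eta> * length S0"
        by (simp add: \<nu>_def m_def)
    qed
    have "measure_pmf.prob (bind_pmf (iid_pmf n2 (unif_list W))
      (\<lambda>S2. return_pmf (erm S2, neg Q + count_neg S2))) {r. \<not> G (fst r)}
      \<le> measure_pmf.prob (iid_pmf n2 (unif_list W)) ?bad + 0"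
      using good by (intro prob_bind_pmf_le) (auto simp: measure_return)
    also have "\<dots> \<le> 8 * exp (- real n2 * e\<^sup>2 / 64)"
    proof -
      have "16 \<le> real n2 * e\<^sup>2" using n2 A by linarith
      from iid_pmf_thresholds_deviation[OF Wne e this] show ?thesis by simp
    qed
    also have "\<dots> \<le> 8 * (\<delta> / 200)" using n2 tail[of "real n2 * e\<^sup>2 / 64"] by simp
    also have "\<dots> \<le> \<delta> / 8" using \<delta> by simp
    finally show ?thesis by (simp add: W_def)
  qed
  have stage2: "measure_pmf.prob (bind_pmf (rss_pmf (2 * u) (\<delta> / 2) S) (\<lambda>Q. bind_pmf (iid_pmf n2 (unif_list (S1 (hat Q))))
      (\<lambda>S2. return_pmf (erm S2, neg Q + count_neg S2)))) {r. \<not> G (fst r)} \<le> \<delta> / 16 + \<delta> / 8"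
    if S: "S \<in> set_pmf (iid_pmf n (unif_list S0))" "S \<notin> bad" for S
  proof -
    have lS: "length S = n" using S(1) by (rule iid_pmf_support)
    define far where "far = {Q. 36 * u < 1 \<and> 14 * u * length S < disagreements a (hat Q) S}"
    have "measure_pmf.prob (bind_pmf (rss_pmf (2 * u) (\<delta> / 2) S) (\<lambda>Q. bind_pmf (iid_pmf n2 (unif_list (S1 (hat Q))))
      (\<lambda>S2. return_pmf (erm S2, neg Q + count_neg S2)))) {r. \<not> G (fst r)}
      \<le> measure_pmf.prob (rss_pmf (2 * u) (\<delta> / 2) S) far + \<delta> / 8"
    proof (rule prob_bind_pmf_le)
      fix Q assume Q: "Q \<notin> far"
      have "disagreements a (hat Q) S0 \<le> 33 * u * m" if "36 * u < 1"
      proof (rule ccontr)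
        assume "\<not> disagreements a (hat Q) S0 \<le> 33 * u * m"
        moreover have "disagreements a (hat Q) S \<le> 14 * u * n" using Q that by (simp add: far_def lS)
        ultimately show False using S(2) unfolding bad_def m_def by force
      qed
      thus "measure_pmf.prob (bind_pmf (iid_pmf n2 (unif_list (S1 (hat Q))))
        (\<lambda>S2. return_pmf (erm S2, neg Q + count_neg S2))) {r. \<not> G (fst r)} \<le> \<delta> / 8"
        by (rule stage3)
    qed (use \<delta> in simp)
    also have "measure_pmf.prob (rss_pmf (2 * u) (\<delta> / 2) S) far \<le> \<delta> / 16"
    proof (cases "36 * u < 1")
      case True
      have "mistakes a S \<le> 3 / 2 * u * length S" using S(2) by (simp add: bad_def lS not_le mult_ac)
      with True show ?thesis
        using u \<delta> a n lS rss_pmf_erm_close[of S u \<delta> a] unfolding far_def hat_def by auto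
    next
      case False
      thus ?thesis using \<delta> by (simp add: far_def)
    qed
    finally show ?thesis by simp
  qed
  have "audit_thr C c \<eta> \<delta> \<alpha> S0 = bind_pmf (iid_pmf n (unif_list S0)) (\<lambda>S.
     bind_pmf (rss_pmf (2 * u) (\<delta> / 2) S) (\<lambda>Q. bind_pmf (iid_pmf n2 (unif_list (S1 (hat Q))))
      (\<lambda>S2. return_pmf (erm S2, neg Q + count_neg S2))))"
    by (simp only: audit_thr_def Let_def n_def n2_def r_def u_def \<nu>_def S1_def hat_def neg_def mult.assoc)
  hence "measure_pmf.prob (audit_thr C c \<eta> \<delta> \<alpha> S0) {r. \<not> G (fst r)} \<le>
     measure_pmf.prob (iid_pmf n (unif_list S0)) bad + (\<delta> / 16 + \<delta> / 8)"
    using stage2 \<delta> by (simp only:, intro prob_bind_pmf_le) auto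
  also have "\<dots> \<le> \<delta> / 2" using P1 \<delta> by simp
  finally show ?thesis .
qed

section \<open>The pool\<close>

lemma (in real_distribution) quantile_exists:
  assumes "0 < q" "q < 1"
  shows "\<exists>g. measure M {..<g} \<le> q \<and> q \<le> measure M {..g}"
proof -
  define X where "X = {x. q \<le> cdf M x}"
  have "eventually (\<lambda>x. q < cdf M x) at_top"
    using cdf_lim_at_top_prob assms(2) by (rule order_tendstoD)
  then obtain x0 where "q < cdf M x0" by (auto simp: eventually_at_top_linorder)
  hence "x0 \<in> X" by (simp add: X_def)
  hence ne: "X \<noteq> {}" by blast
  have "eventually (\<lambda>x. cdf M x < q) at_bot"
    using cdf_lim_at_bot assms(1) by (rule order_tendstoD)
  then obtain x1 where x1: "\<And>x. x \<le> x1 \<Longrightarrow> cdf M x < q" by (auto simp: eventually_at_bot_linorder)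
  have bdd: "bdd_below X"
  proof (rule bdd_belowI[of _ x1])
    fix x assume "x \<in> X"
    thus "x1 \<le> x" using x1[of x] by (cases "x \<le> x1") (auto simp: X_def)
  qed
  \<comment> \<open>At an atom the distribution function may jump across \<open>q\<close>; right
    continuity and the left limit give the two one-sided bounds.\<close>
  define g where "g = Inf X"
  have above: "q \<le> cdf M x" if gx: "g < x" for x
  proof -
    obtain y where "y \<in> X" "y < x" using gx ne bdd unfolding g_def by (auto simp: cInf_less_iff)
    thus ?thesis using cdf_nondecreasing[of y x] by (simp add: X_def)
  qed
  have below: "cdf M x < q" if "x < g" for x
    using that bdd unfolding g_def X_def by (meson cInf_lower linorder_not_less mem_Collect_eq)
  have "q \<le> cdf M g"
  proof (rule tendsto_lowerbound)
    show "(cdf M \<longlongrightarrow> cdf M g) (at_right g)"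
      using cdf_is_right_cont[of g] by (simp add: continuous_within)
    show "\<forall>\<^sub>F x in at_right g. q \<le> cdf M x"
      using above by (auto simp: eventually_at_filter)
  qed simp
  moreover have "measure M {..<g} \<le> q"
  proof (rule tendsto_upperbound)
    show "(cdf M \<longlongrightarrow> measure M {..<g}) (at_left g)" by (rule cdf_at_left)
    show "\<forall>\<^sub>F x in at_left g. cdf M x \<le> q"
      using below by (auto simp: eventually_at_filter less_imp_le)
  qed simp
  ultimately show ?thesis by (auto simp: cdf_def)
qed

text \<open>The closed ray up to a quantile carries mass at least \<open>q\<close>, and an open ray
  heavier than \<open>q\<close> must pass beyond the quantile. For \<open>q \<le> 0\<close> the
  empty set serves.\<close>

lemma (in real_distribution) lower_bracket_exists:
  assumes "q < 1"
  shows "\<exists>L\<in>sets borel. q \<le> measure M L \<and> (\<forall>b. q < measure M {..<b} \<longrightarrow> L \<subseteq> {..<b})"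
proof (cases "q \<le> 0")
  case True
  thus ?thesis by (intro bexI[of _ "{}"]) auto
next
  case False
  with assms obtain g where g: "measure M {..<g} \<le> q" "q \<le> measure M {..g}"
    using quantile_exists[of q] by auto
  have "{..g} \<subseteq> {..<b}" if "q < measure M {..<b}" for b
  proof (rule ccontr)
    assume "\<not> {..g} \<subseteq> {..<b}"
    hence "{..<b} \<subseteq> {..<g}" by auto
    hence "measure M {..<b} \<le> measure M {..<g}" by (intro finite_measure_mono) auto
    thus False using that g by linarith
  qed
  thus ?thesis using g by (intro bexI[of _ "{..g}"]) auto
qed

lemma (in real_distribution) upper_bracket_exists:
  assumes "0 < q"
  shows "\<exists>U\<in>sets borel. measure M U \<le> q \<and> (\<forall>b. measure M {..<b} < q \<longrightarrow> {..<b} \<subseteq> U)"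
proof (cases "1 \<le> q")
  case True
  thus ?thesis using prob_le_1 order_trans by (intro bexI[of _ "UNIV"]) auto
next
  case False
  with assms obtain g where g: "measure M {..<g} \<le> q" "q \<le> measure M {..g}"
    using quantile_exists[of q] by auto
  have "{..<b} \<subseteq> {..<g}" if "measure M {..<b} < q" for b
  proof (rule ccontr)
    assume "\<not> {..<b} \<subseteq> {..<g}"
    hence "{..g} \<subseteq> {..<b}" by auto
    hence "measure M {..g} \<le> measure M {..<b}" by (intro finite_measure_mono) auto
    thus False using that g by linarith
  qed
  thus ?thesis using g by (intro bexI[of _ "{..<g}"]) auto
qed

lemma sets_Times_label:
  assumes "A \<in> sets borel"
  shows "A \<times> B \<in> sets (borel :: point measure)"
proof -
  have "fst \<in> measurable (borel :: point measure) borel" "snd \<in> measurable (borel :: point measure) borel"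
    by (intro borel_measurable_continuous_onI continuous_on_fst continuous_on_snd continuous_on_id)+
  moreover have "B \<in> sets borel" by (simp add: sets_borel_eq_count_space)
  ultimately have "fst -` A \<inter> snd -` B \<in> sets (borel :: point measure)"
    using assms by (metis measurable_sets_borel sets.Int)
  moreover have "A \<times> B = fst -` A \<inter> snd -` B" by auto
  ultimately show ?thesis by simp
qed

lemma sets_mistake:
  "{p. thr b (fst p) \<noteq> snd p} \<in> sets (borel :: point measure)"
proof -
  have "{p. thr b (fst p) \<noteq> snd p} = ({b..} \<times> - {1}) \<union> ({..<b} \<times> - {-1::int})"
    by (auto simp: thr_def)
  thus ?thesis by (simp only:) (intro sets.Un sets_Times_label, auto)
qed

text \<open>The brackets are indexed by the multiple of \<open>\<kappa>\<close> just below the mass to the left of the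
  threshold; the marginal may have atoms, so the two bracket ends are chosen independently.\<close>
lemma mistake_lower_brackets:
  fixes D :: "point measure"
  assumes D: "prob_space D" "sets D = sets borel" and lab: "AE p in D. snd p \<in> {-1, 1}" and k: "0 < \<kappa>"
  shows "\<exists>R :: nat \<Rightarrow> point set. (\<forall>j. R j \<in> sets D) \<and>
    (\<forall>b. \<exists>j \<le> nat \<lfloor>1 / \<kappa>\<rfloor>. R j \<subseteq> {p. thr b (fst p) \<noteq> snd p} \<and> err_D D (thr b) \<le> measure D (R j) + 2 * \<kappa>)"
proof -
  interpret D: prob_space D by (rule D)
  define M where "M = distr D borel fst"
  have "fst \<in> measurable (borel :: point measure) borel"
    by (intro borel_measurable_continuous_onI continuous_on_fst continuous_on_id)
  hence fst_m [measurable]: "fst \<in> measurable D borel"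
    by (simp add: measurable_cong_sets[OF D(2) refl])
  interpret M: real_distribution M unfolding M_def by (rule D.real_distribution_distr) simp
  have spD: "space D = UNIV" using sets_eq_imp_space_eq[OF D(2)] by simp
  have meas: "measure M X = measure D (fst -` X)" if "X \<in> sets borel" for X
    using that by (simp add: M_def measure_distr spD)
  have vim: "fst -` X \<in> sets D" if "X \<in> sets borel" for X
    using measurable_sets[OF fst_m that] by (simp add: spD)
  \<comment> \<open>The level is \<open>j - 1\<close> because the mass left of \<open>b\<close> is
    only known to be at least \<open>j * \<kappa>\<close>, while a lower bracket needs strict
    excess. The guard keeps the level below 1, as the bracket lemma demands.\<close>
  have "\<forall>j. \<exists>L\<in>sets borel. (real j - 1) * \<kappa> < 1 \<longrightarrow>
     (real j - 1) * \<kappa> \<le> measure M L \<and> (\<forall>b. (real j - 1) * \<kappa> < measure M {..<b} \<longrightarrow> L \<subseteq> {..<b})"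
    using M.lower_bracket_exists by (metis sets.empty_sets)
  then obtain L where L: "\<And>j. L j \<in> sets borel" "\<And>j. (real j - 1) * \<kappa> < 1 \<Longrightarrow> (real j - 1) * \<kappa> \<le> measure M (L j)"
    "\<And>j b. (real j - 1) * \<kappa> < 1 \<Longrightarrow> (real j - 1) * \<kappa> < measure M {..<b} \<Longrightarrow> L j \<subseteq> {..<b}"
    by metis
  have "\<forall>j. \<exists>U\<in>sets borel. measure M U \<le> (real j + 1) * \<kappa> \<and> (\<forall>b. measure M {..<b} < (real j + 1) * \<kappa> \<longrightarrow> {..<b} \<subseteq> U)"
    using k by (intro allI M.upper_bracket_exists) (simp add: add_nonneg_pos)
  then obtain U where U: "\<And>j. U j \<in> sets borel" "\<And>j. measure M (U j) \<le> (real j + 1) * \<kappa>"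
    "\<And>j b. measure M {..<b} < (real j + 1) * \<kappa> \<Longrightarrow> {..<b} \<subseteq> U j"
    by metis
  \<comment> \<open>Mistakes common to all thresholds of the bracket: points in \<open>L j\<close>
    are predicted -1, points outside \<open>U j\<close> are predicted +1.\<close>
  define R where "R j = (L j \<times> {1}) \<union> ((- U j) \<times> {-1::int})" for j
  have Rm: "R j \<in> sets D" for j
    unfolding R_def D(2) using L(1)[of j] U(1)[of j]
    by (intro sets.Un sets_Times_label) auto
  have "\<exists>j \<le> nat \<lfloor>1 / \<kappa>\<rfloor>. R j \<subseteq> {p. thr b (fst p) \<noteq> snd p} \<and> err_D D (thr b) \<le> measure D (R j) + 2 * \<kappa>" for b
  proof -
    define F where "F = measure M {..<b}"
    have F: "0 \<le> F" "F \<le> 1" by (auto simp: F_def)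
    define j where "j = nat \<lfloor>F / \<kappa>\<rfloor>"
    have "real j \<le> F / \<kappa>" "F / \<kappa> < real j + 1" using F k by (auto simp: j_def)
    hence j: "real j * \<kappa> \<le> F" "F < (real j + 1) * \<kappa>" using k by (auto simp: field_simps)
    have "F / \<kappa> \<le> 1 / \<kappa>" using F k by (intro divide_right_mono) auto
    hence jle: "j \<le> nat \<lfloor>1 / \<kappa>\<rfloor>" unfolding j_def by (intro nat_mono floor_mono)
    have lo: "(real j - 1) * \<kappa> < F" using j k by (simp add: algebra_simps)
    hence lo1: "(real j - 1) * \<kappa> < 1" using F by linarith
    have Lb: "L j \<subseteq> {..<b}" using L(3)[OF lo1] lo by (simp add: F_def)
    have Ub: "{..<b} \<subseteq> U j" using U(3)[of b j] j by (simp add: F_def)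
    have inL: "x < b" if "x \<in> L j" for x using that Lb by auto
    have notU: "b \<le> x" if "x \<notin> U j" for x using that Ub by (meson lessThan_iff not_le subsetD)
    have sub: "R j \<subseteq> {p. thr b (fst p) \<noteq> snd p}"
      using inL notU unfolding R_def thr_def by fastforce
    have gap: "measure D (fst -` (U j - L j)) \<le> 2 * \<kappa>"
    proof -
      have "measure D (fst -` (U j - L j)) = measure M (U j) - measure M (L j)"
        using L(1) U(1) Lb Ub by (subst meas[symmetric]) (auto intro!: M.finite_measure_Diff)
      also have "\<dots> \<le> (real j + 1) * \<kappa> - (real j - 1) * \<kappa>"
        using U(2)[of j] L(2)[OF lo1] by linarith
      finally show ?thesis by (simp add: algebra_simps)
    qed
    have "measure D {p. thr b (fst p) \<noteq> snd p} \<le> measure D (R j \<union> fst -` (U j - L j))"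
    proof (rule D.finite_measure_mono_AE)
      show "AE p in D. p \<in> {p. thr b (fst p) \<noteq> snd p} \<longrightarrow> p \<in> R j \<union> fst -` (U j - L j)"
        using lab
      proof eventually_elim
        case (elim p)
        show ?case using elim inL[of "fst p"] notU[of "fst p"]
          by (cases p) (auto simp: R_def thr_def split: if_splits)
      qed
      show "R j \<union> fst -` (U j - L j) \<in> sets D" using Rm[of j] vim[of "U j - L j"] L(1) U(1) by auto
    qed
    also have "\<dots> \<le> measure D (R j) + measure D (fst -` (U j - L j))"
      using Rm[of j] vim[of "U j - L j"] L(1) U(1) by (intro measure_Un_le) auto
    finally have "err_D D (thr b) \<le> measure D (R j) + 2 * \<kappa>" using gap by (simp add: err_D_def)
    thus ?thesis using jle sub by blast
  qed
  thus ?thesis using Rm by blast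
qed

section \<open>Concentration of counts in the pool\<close>

lemma (in prob_space) product_count_Chernoff:
  assumes A [measurable]: "A \<in> events" and l: "\<bar>l\<bar> \<le> 1"
  shows "measure (PiM {..<m} (\<lambda>_. M)) {S\<in>space (PiM {..<m} (\<lambda>_. M)). t \<le> l * (\<Sum>i<m. indicator A (S i))}
    \<le> exp (real m * ((l + l\<^sup>2) * prob A) - t)"
proof -
  let ?P = "PiM {..<m} (\<lambda>_. M)"
  interpret P: product_prob_space "\<lambda>_::nat. M" "{..<m}" by unfold_locales
  let ?f = "\<lambda>x. ennreal (exp (l * indicator A x))"
  have fm: "?f \<in> borel_measurable M" by measurable
  have e: "(\<Prod>i<m. ?f (S i)) = ennreal (exp (l * (\<Sum>i<m. indicator A (S i))))" for S :: "nat \<Rightarrow> 'a"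
    by (simp only: prod_ennreal exp_ge_zero sum_distrib_left exp_sum[OF finite_lessThan])
  have [measurable]: "(\<lambda>S. \<Prod>i<m. ?f (S i)) \<in> borel_measurable ?P" by measurable
  have "emeasure ?P {S\<in>space ?P. 1 \<le> ennreal (exp (- t)) * (\<Prod>i<m. ?f (S i))}
     \<le> ennreal (exp (- t)) * (\<integral>\<^sup>+ S. (\<Prod>i<m. ?f (S i)) * indicator (space ?P) S \<partial>?P)"
    by (rule nn_integral_Markov_inequality) auto
  also have "(\<integral>\<^sup>+ S. (\<Prod>i<m. ?f (S i)) * indicator (space ?P) S \<partial>?P) = (\<integral>\<^sup>+ S. (\<Prod>i<m. ?f (S i)) \<partial>?P)"
    by (intro nn_integral_cong) (simp split: split_indicator)
  also have "\<dots> = (\<Prod>i<m. \<integral>\<^sup>+ x. ?f x \<partial>M)"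
    using fm by (intro P.product_nn_integral_prod) auto
  also have "\<dots> \<le> (\<Prod>i<m. ennreal (exp ((l + l\<^sup>2) * prob A)))"
    unfolding prod_constant using A l by (intro power_mono nn_integral_exp_indicator_le) auto
  also have "ennreal (exp (- t)) * \<dots> = ennreal (exp (real m * ((l + l\<^sup>2) * prob A) - t))"
    by (simp add: ennreal_power exp_of_nat_mult[symmetric] ennreal_mult[symmetric] exp_add[symmetric])
  also have "{S\<in>space ?P. 1 \<le> ennreal (exp (- t)) * (\<Prod>i<m. ?f (S i))} =
     {S\<in>space ?P. t \<le> l * (\<Sum>i<m. indicator A (S i))}"
    unfolding e by (auto simp: ennreal_mult[symmetric] exp_add[symmetric])
  finally show ?thesis
    by (simp add: P.emeasure_eq_measure mult_left_mono)
qed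

lemma length_filter_map_upt:
  "real (length (filter P (map S [0..<m]))) = (\<Sum>i<m. indicator {x. P x} (S i))"
  by (induction m) auto

text \<open>The first bound makes one tail small enough for a union over
  \<open>3 / (\<nu> * \<eta>)\<close> brackets; the second keeps rounding errors in the window size
  small.\<close>

lemma pool_size_bounds:
  fixes \<eta> \<delta> \<alpha> C c :: real
  assumes C: "1000000 \<le> C" "100 \<le> c"
    and \<eta>: "0 < \<eta>" "\<eta> < 1" and \<delta>: "0 < \<delta>" "\<delta> < 1" and \<alpha>: "0 < \<alpha>" "\<alpha> < 1"
  defines "m \<equiv> pool_size C c \<eta> \<delta> \<alpha>" and "\<nu> \<equiv> \<alpha> / 5"
  shows "exp (- (\<nu>\<^sup>2 * \<eta> * m / 300)) \<le> \<nu> * \<eta> * \<delta> / 20000" and "1 \<le> \<eta> * m"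
proof -
  define X where "X = \<nu>\<^sup>2 * \<eta> * m"
  define B where "B = ln (c / (\<nu> * \<eta>)) + ln (c / (\<delta> / 2))"
  have \<nu>: "0 < \<nu>" "\<nu> < 1" using \<alpha> by (auto simp: \<nu>_def)
  have \<nu>\<eta>: "0 < \<nu> * \<eta>" "\<nu> * \<eta> < 1" using \<nu> \<eta> mult_strict_mono[of \<nu> 1 \<eta> 1] by auto
  have le: "100 / (\<nu> * \<eta>) \<le> c / (\<nu> * \<eta>)" "200 / \<delta> \<le> c / (\<delta> / 2)"
    using C \<nu>\<eta> \<delta> by (auto simp: divide_right_mono field_simps)
  have "ln (100 / (\<nu> * \<eta>)) + ln (200 / \<delta>) \<le> B"
    unfolding B_def using le \<nu>\<eta> \<delta> C by (intro add_mono ln_mono) auto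
  moreover have "ln (100 / (\<nu> * \<eta>)) + ln (200 / \<delta>) = ln (20000 / (\<nu> * \<eta> * \<delta>))"
    using \<nu>\<eta> \<delta> \<nu> \<eta> by (subst ln_mult_pos[symmetric]) auto
  ultimately have B: "ln (20000 / (\<nu> * \<eta> * \<delta>)) \<le> B" by simp
  have small: "0 < \<nu> * \<eta> * \<delta>" "\<nu> * \<eta> * \<delta> < 1" using \<nu>\<eta> \<delta> mult_strict_mono[of "\<nu> * \<eta>" 1 \<delta> 1] by auto
  have "exp 1 \<le> (3::real)" by (rule exp_le)
  also have "\<dots> \<le> 20000 / (\<nu> * \<eta> * \<delta>)" using small by (simp add: field_simps)
  finally have "1 \<le> ln (20000 / (\<nu> * \<eta> * \<delta>))" using small by (simp add: ln_ge_iff)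
  hence B1: "1 \<le> B" using B by simp
  have "C * B / (\<nu>\<^sup>2 * \<eta>) \<le> m"
    unfolding m_def pool_size_def m_nu_def B_def \<nu>_def by (simp add: real_nat_ceiling_ge)
  hence "C * B \<le> X" using \<nu> \<eta> by (simp add: X_def field_simps)
  moreover have "1000000 * B \<le> C * B" using C B1 by (intro mult_right_mono) auto
  ultimately have XB: "1000000 * B \<le> X" by simp
  have "exp (- (X / 300)) \<le> exp (- ln (20000 / (\<nu> * \<eta> * \<delta>)))" using XB B B1 by simp
  also have "\<dots> = \<nu> * \<eta> * \<delta> / 20000" using small by (simp add: exp_minus)
  finally show "exp (- (\<nu>\<^sup>2 * \<eta> * m / 300)) \<le> \<nu> * \<eta> * \<delta> / 20000" by (simp add: X_def)
  have "\<nu>\<^sup>2 \<le> 1" using \<nu> by (simp add: power_le_one)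
  hence "\<nu>\<^sup>2 * (\<eta> * m) \<le> 1 * (\<eta> * m)" using \<eta> by (intro mult_right_mono) auto
  thus "1 \<le> \<eta> * m" using XB B1 by (simp add: X_def)
qed

text \<open>Chernoff bounds are needed only for \<open>a\<close> and for each heavy bracket. The
  mistake set of any \<open>b\<close> contains a bracket, so few pool mistakes of \<open>b\<close>
  mean that this bracket is not heavy.\<close>

lemma good_pool_event:
  fixes \<eta> \<delta> \<alpha> C c a :: real and D :: "point measure"
  assumes C: "1000000 \<le> C" "100 \<le> c"
    and \<eta>: "0 < \<eta>" "\<eta> < 1" and \<delta>: "0 < \<delta>" "\<delta> < 1" and \<alpha>: "0 < \<alpha>" "\<alpha> < 1"
    and D: "prob_space D" "sets D = sets borel" and lab: "AE p in D. snd p \<in> {-1, 1}"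
    and a: "err_D D (thr a) \<le> (1 + \<alpha> / 40) * \<eta>"
  defines "m \<equiv> pool_size C c \<eta> \<delta> \<alpha>"
  defines "P \<equiv> PiM {..<m} (\<lambda>_. D)"
  shows "\<exists>E\<in>sets P. 1 - \<delta> / 4 \<le> measure P E \<and> (\<forall>S\<in>E.
     mistakes a (map S [0..<m]) \<le> (1 + \<alpha> / 20) * \<eta> * m \<and>
     (\<forall>b. mistakes b (map S [0..<m]) \<le> (1 + 2 * (\<alpha> / 5)) * \<eta> * m \<longrightarrow> err_D D (thr b) \<le> (1 + \<alpha>) * \<eta>))"
proof -
  interpret D: prob_space D by (rule D)
  interpret P: product_prob_space "\<lambda>_::nat. D" "{..<m}" by unfold_locales
  interpret Pp: prob_space P unfolding P_def by (rule P.prob_space_axioms)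
  define \<nu> where "\<nu> = \<alpha> / 5"
  have \<nu>: "0 < \<nu>" "\<nu> < 1 / 5" using \<alpha> by (auto simp: \<nu>_def)
  define tail where "tail = \<nu> * \<eta> * \<delta> / 20000"
  have X: "exp (- (\<nu>\<^sup>2 * \<eta> * m / 300)) \<le> tail"
    unfolding m_def \<nu>_def tail_def using C \<eta> \<delta> \<alpha> by (rule pool_size_bounds)
  \<comment> \<open>The bracket loss becomes \<open>2 * \<kappa> = \<nu> * \<eta>\<close>, so true
    error above \<open>(1 + 5 * \<nu>) * \<eta>\<close> leaves bracket mass at least
    \<open>(1 + 4 * \<nu>) * \<eta>\<close>.\<close>
  define \<kappa> where "\<kappa> = \<nu> * \<eta> / 2"
  have k: "0 < \<kappa>" using \<nu> \<eta> by (simp add: \<kappa>_def)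
  obtain R :: "nat \<Rightarrow> point set" where R: "\<And>j. R j \<in> sets D"
    "\<And>b. \<exists>j \<le> nat \<lfloor>1 / \<kappa>\<rfloor>. R j \<subseteq> {p. thr b (fst p) \<noteq> snd p} \<and> err_D D (thr b) \<le> measure D (R j) + 2 * \<kappa>"
    using mistake_lower_brackets[OF D lab k] by blast
  define cnt where "cnt A S = (\<Sum>i<m. indicator A (S i) :: real)" for A :: "point set" and S :: "nat \<Rightarrow> point"
  have cnt_m: "cnt A \<in> borel_measurable P" if A [measurable]: "A \<in> sets D" for A
    unfolding cnt_def P_def by measurable
  define Ea where "Ea = {p. thr a (fst p) \<noteq> snd p}"
  have Ea: "Ea \<in> sets D" unfolding Ea_def D(2) by (rule sets_mistake)
  define J where "J = {j. j \<le> nat \<lfloor>1 / \<kappa>\<rfloor> \<and> (1 + 4 * \<nu>) * \<eta> \<le> measure D (R j)}"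
  have finJ: "finite J" unfolding J_def by simp
  define B0 where "B0 = {S\<in>space P. real m * ((1 + \<nu> / 4) * \<eta>) \<le> cnt Ea S}"
  define B where "B j = {S\<in>space P. cnt (R j) S \<le> real m * ((1 + 2 * \<nu>) * \<eta>)}" for j
  have B0m: "B0 \<in> sets P" unfolding B0_def using cnt_m[OF Ea] by simp
  have Bm: "B j \<in> sets P" for j unfolding B_def using cnt_m[OF R(1)] by simp
  have P0: "measure P B0 \<le> tail"
  proof -
    \<comment> \<open>The margin between \<open>1 + \<nu> / 8\<close> and
      \<open>1 + \<nu> / 4\<close> gains \<open>l * \<nu> / 8\<close>, which must beat a loss of
      about \<open>l\<^sup>2\<close>.\<close>
    define l where "l = \<nu> / 20"
    have l: "0 < l" "l \<le> 1" using \<nu> by (auto simp: l_def)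
    have "measure P B0 \<le> measure P {S\<in>space P. l * (real m * ((1 + \<nu> / 4) * \<eta>)) \<le> l * (\<Sum>i<m. indicator Ea (S i))}"
      unfolding B0_def cnt_def using l by (intro eq_refl arg_cong[of _ _ "measure P"]) auto
    also have "\<dots> \<le> exp (real m * ((l + l\<^sup>2) * measure D Ea) - l * (real m * ((1 + \<nu> / 4) * \<eta>)))"
      unfolding P_def using Ea l by (intro D.product_count_Chernoff) auto
    also have "\<dots> \<le> exp (- (\<nu>\<^sup>2 * \<eta> * m / 300))"
    proof -
      have "(l + l\<^sup>2) * measure D Ea \<le> (l + l\<^sup>2) * ((1 + \<nu> / 8) * \<eta>)"
        using a l by (intro mult_left_mono) (auto simp: err_D_def Ea_def \<nu>_def)
      also have "\<dots> = l * ((1 + \<nu> / 4) * \<eta>) - l * \<nu> * \<eta> / 8 + l\<^sup>2 * (1 + \<nu> / 8) * \<eta>"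
        by (simp add: algebra_simps)
      also have "l\<^sup>2 * (1 + \<nu> / 8) * \<eta> \<le> l\<^sup>2 * (41 / 40) * \<eta>"
        using \<nu> \<eta> by (intro mult_right_mono mult_left_mono) auto
      also have "l * ((1 + \<nu> / 4) * \<eta>) - l * \<nu> * \<eta> / 8 + l\<^sup>2 * (41 / 40) * \<eta> =
          l * ((1 + \<nu> / 4) * \<eta>) - 59 / 16000 * (\<nu>\<^sup>2 * \<eta>)"
        by (simp add: l_def power2_eq_square algebra_simps)
      also have "\<dots> \<le> l * ((1 + \<nu> / 4) * \<eta>) - 1 / 300 * (\<nu>\<^sup>2 * \<eta>)"
        using \<eta> by (intro diff_left_mono mult_right_mono) auto
      finally have "real m * ((l + l\<^sup>2) * measure D Ea) \<le> real m * (l * ((1 + \<nu> / 4) * \<eta>) - 1 / 300 * (\<nu>\<^sup>2 * \<eta>))"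
        by (rule mult_left_mono) simp_all
      thus ?thesis by (simp add: algebra_simps)
    qed
    finally show ?thesis using X by linarith
  qed
  have PB: "measure P (B j) \<le> tail" if j: "j \<in> J" for j
  proof -
    \<comment> \<open>Here the margin is \<open>2 * \<nu>\<close>, which permits a larger
      \<open>l\<close>.\<close>
    define l where "l = \<nu> / 2"
    have l: "0 < l" "l < 1" using \<nu> by (auto simp: l_def)
    have "measure P (B j) \<le> measure P {S\<in>space P. (- l) * (real m * ((1 + 2 * \<nu>) * \<eta>)) \<le> (- l) * (\<Sum>i<m. indicator (R j) (S i))}"
      unfolding B_def cnt_def using l by (intro eq_refl arg_cong[of _ _ "measure P"]) auto
    also have "\<dots> \<le> exp (real m * ((- l + (- l)\<^sup>2) * measure D (R j)) - (- l) * (real m * ((1 + 2 * \<nu>) * \<eta>)))"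
      unfolding P_def using R(1) l by (intro D.product_count_Chernoff) auto
    also have "\<dots> \<le> exp (- (\<nu>\<^sup>2 * \<eta> * m / 300))"
    proof -
      have "l * l \<le> l * 1" using l by (intro mult_left_mono) auto
      hence "(l - l\<^sup>2) * ((1 + 4 * \<nu>) * \<eta>) \<le> (l - l\<^sup>2) * measure D (R j)"
        using j by (intro mult_left_mono) (auto simp: J_def power2_eq_square)
      hence "(- l + (- l)\<^sup>2) * measure D (R j) \<le> - ((l - l\<^sup>2) * ((1 + 4 * \<nu>) * \<eta>))"
        by (simp add: algebra_simps)
      also have "\<dots> = - l * ((1 + 2 * \<nu>) * \<eta>) - 2 * l * \<nu> * \<eta> + l\<^sup>2 * (1 + 4 * \<nu>) * \<eta>"
        by (simp add: algebra_simps)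
      also have "l\<^sup>2 * (1 + 4 * \<nu>) * \<eta> \<le> l\<^sup>2 * (9 / 5) * \<eta>"
        using \<nu> \<eta> by (intro mult_right_mono mult_left_mono) auto
      also have "- l * ((1 + 2 * \<nu>) * \<eta>) - 2 * l * \<nu> * \<eta> + l\<^sup>2 * (9 / 5) * \<eta> =
          - l * ((1 + 2 * \<nu>) * \<eta>) - 11 / 20 * (\<nu>\<^sup>2 * \<eta>)"
        by (simp add: l_def power2_eq_square algebra_simps)
      also have "\<dots> \<le> - l * ((1 + 2 * \<nu>) * \<eta>) - 1 / 300 * (\<nu>\<^sup>2 * \<eta>)"
        using \<eta> by (intro diff_left_mono mult_right_mono) auto
      finally have "real m * ((- l + (- l)\<^sup>2) * measure D (R j)) \<le> real m * (- l * ((1 + 2 * \<nu>) * \<eta>) - 1 / 300 * (\<nu>\<^sup>2 * \<eta>))"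
        by (rule mult_left_mono) simp_all
      thus ?thesis by (simp add: algebra_simps)
    qed
    finally show ?thesis using X by linarith
  qed
  define Bad where "Bad = B0 \<union> (\<Union>j\<in>J. B j)"
  have Badm: "Bad \<in> sets P" unfolding Bad_def using B0m Bm finJ by auto
  have "measure P Bad \<le> measure P B0 + measure P (\<Union>j\<in>J. B j)"
    unfolding Bad_def using B0m Bm finJ by (intro measure_Un_le) auto
  also have "measure P (\<Union>j\<in>J. B j) \<le> (\<Sum>j\<in>J. measure P (B j))"
    using Bm finJ by (intro measure_UNION_le) auto
  also have "\<dots> \<le> real (card J) * tail" using PB by (rule sum_bounded_above)
  also have "\<dots> \<le> (3 / (\<nu> * \<eta>)) * tail"
  proof (rule mult_right_mono)
    have "card J \<le> card {..nat \<lfloor>1 / \<kappa>\<rfloor>}" by (intro card_mono) (auto simp: J_def)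
    hence "card J \<le> nat \<lfloor>1 / \<kappa>\<rfloor> + 1" by simp
    moreover have "real (nat \<lfloor>1 / \<kappa>\<rfloor>) \<le> 1 / \<kappa>" using k by simp
    ultimately have "real (card J) \<le> 1 / \<kappa> + 1" by linarith
    also have "\<dots> = 2 / (\<nu> * \<eta>) + 1" by (simp add: \<kappa>_def)
    also have "\<dots> \<le> 2 / (\<nu> * \<eta>) + 1 / (\<nu> * \<eta>)"
    proof -
      have "0 < \<nu> * \<eta>" "\<nu> * \<eta> \<le> 1" using \<nu> \<eta> by (auto intro!: mult_le_one)
      thus ?thesis by (intro add_left_mono) (simp only: le_divide_eq_1_pos)
    qed
    also have "\<dots> = 3 / (\<nu> * \<eta>)" by (simp add: add_divide_distrib[symmetric])
    finally show "real (card J) \<le> 3 / (\<nu> * \<eta>)" .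
    show "0 \<le> tail" using \<nu> \<eta> \<delta> by (simp add: tail_def)
  qed
  also have "(3 / (\<nu> * \<eta>)) * tail = 3 * \<delta> / 20000" using \<nu> \<eta> by (simp add: tail_def)
  finally have "measure P Bad \<le> measure P B0 + 3 * \<delta> / 20000" by simp_all
  moreover have "tail \<le> 1 * \<delta> / 20000" unfolding tail_def
    using \<nu> \<eta> \<delta> mult_strict_mono[of \<nu> 1 \<eta> 1] by (intro divide_right_mono mult_right_mono) auto
  ultimately have PBad: "measure P Bad \<le> \<delta> / 4" using P0 \<delta> by linarith
  show ?thesis
  proof (intro bexI[of _ "space P - Bad"] conjI ballI allI impI)
    show "space P - Bad \<in> sets P" using Badm by auto
    show "1 - \<delta> / 4 \<le> measure P (space P - Bad)" using Pp.prob_compl[OF Badm] PBad by simp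
  next
    fix S assume S: "S \<in> space P - Bad"
    show "mistakes a (map S [0..<m]) \<le> (1 + \<alpha> / 20) * \<eta> * m"
    proof -
      have "cnt Ea S < real m * ((1 + \<nu> / 4) * \<eta>)" using S by (auto simp: Bad_def B0_def not_le)
      thus ?thesis unfolding length_filter_map_upt cnt_def Ea_def \<nu>_def by (simp add: mult_ac)
    qed
    fix b assume b: "mistakes b (map S [0..<m]) \<le> (1 + 2 * (\<alpha> / 5)) * \<eta> * m"
    show "err_D D (thr b) \<le> (1 + \<alpha>) * \<eta>"
    proof (rule ccontr)
      assume far: "\<not> err_D D (thr b) \<le> (1 + \<alpha>) * \<eta>"
      obtain j where j: "j \<le> nat \<lfloor>1 / \<kappa>\<rfloor>" "R j \<subseteq> {p. thr b (fst p) \<noteq> snd p}"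
        "err_D D (thr b) \<le> measure D (R j) + 2 * \<kappa>" using R(2) by blast
      have "(1 + 4 * \<nu>) * \<eta> \<le> measure D (R j)"
        using far j(3) by (simp add: \<kappa>_def \<nu>_def algebra_simps)
      hence "S \<notin> B j" using S j(1) by (auto simp: Bad_def J_def)
      hence "real m * ((1 + 2 * \<nu>) * \<eta>) < cnt (R j) S" using S by (auto simp: B_def)
      also have "\<dots> \<le> real (mistakes b (map S [0..<m]))"
        unfolding length_filter_map_upt cnt_def using j(2) by (intro sum_mono) (auto split: split_indicator)
      finally show False using b by (simp add: \<nu>_def mult_ac)
    qed
  qed
qed

text \<open>The stopping rule caps the first phase at \<open>2 * k + 1\<close> negatives, and the
  sample size caps the second. The summand 1 beside \<open>ln (1 / \<delta>)\<close> is there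
  because the logarithm vanishes as \<open>\<delta>\<close> tends to 1.\<close>

lemma audit_thr_queries:
  fixes \<eta> \<delta> \<alpha> C c :: real
  assumes C: "0 \<le> C" "1 \<le> c"
    and \<eta>: "0 < \<eta>" "\<eta> < 1" and \<delta>: "0 < \<delta>" "\<delta> < 1" and \<alpha>: "0 < \<alpha>" "\<alpha> < 1"
    and r: "r \<in> set_pmf (audit_thr C c \<eta> \<delta> \<alpha> S0)"
  shows "real (snd r) \<le> (88 + 129600 * C * (1 + ln (2 * c))) * (1 + ln (1 / \<delta>)) / \<alpha>\<^sup>2"
proof -
  define u where "u = (1 + \<alpha> / 5) * \<eta>"
  have u: "0 < u" using \<alpha> \<eta> by (simp add: u_def)
  define n2 where "n2 = nat \<lceil>m_ag C c (\<alpha> / 5 / 72) (\<delta> / 2) 1\<rceil>"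
  define k where "k = nat \<lceil>14 * ln (8 / (\<delta> / 2))\<rceil>"
  define T where "T = max (nat \<lfloor>1 / (3 * (2 * (1 + \<alpha> / 5) * \<eta>))\<rfloor>) 1"
  define x where "x = 1 / (6 * u)"
  have Tx: "T = max (nat \<lfloor>x\<rfloor>) 1" by (simp add: T_def x_def u_def mult_ac)
  define l where "l = ln (1 / \<delta>)"
  have l: "0 \<le> l" using \<delta> by (simp add: l_def)
  obtain S Q S2 where Q: "Q \<in> set_pmf (rss_pmf (2 * (1 + \<alpha> / 5) * \<eta>) (\<delta> / 2) S)"
    and S2: "length S2 = n2" and s: "snd r = count_neg (take_negs (nat \<lceil>12 * real (length Q) * (1 + \<alpha> / 5) * \<eta>\<rceil> + 1)
      (rev (sort_key fst Q))) + count_neg S2"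
    using r unfolding audit_thr_def Let_def n2_def by (auto dest!: iid_pmf_support(1))
  define N where "N = nat \<lceil>12 * real (length Q) * (1 + \<alpha> / 5) * \<eta>\<rceil> + 1"
  have lQ: "length Q = T * k" unfolding T_def k_def by (rule rss_pmf_length[OF Q])
  have c1: "count_neg (take_negs N (rev (sort_key fst Q))) \<le> 2 * k + 1"
  proof (cases "1 \<le> x")
    case True
    hence "real T \<le> x" unfolding Tx by linarith
    hence "real T * (6 * u) \<le> x * (6 * u)" using u by (intro mult_right_mono) auto
    hence "real T * (6 * u) \<le> 1" using u by (simp add: x_def)
    hence "(2 * real k) * (real T * (6 * u)) \<le> 2 * real k * 1" by (intro mult_left_mono) auto
    hence "12 * real (length Q) * (1 + \<alpha> / 5) * \<eta> \<le> 2 * real k"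
      unfolding lQ u_def by (simp add: mult_ac)
    hence "N \<le> 2 * k + 1" unfolding N_def by linarith
    thus ?thesis using count_neg_take_negs_le[of N "rev (sort_key fst Q)"] by simp
  next
    case False
    \<comment> \<open>When the maximum forces \<open>T = 1\<close>, the stopping rule may allow more
      negatives, but only \<open>k\<close> points exist.\<close>
    hence "T = 1" unfolding Tx by simp
    hence "length Q = k" by (simp add: lQ)
    moreover have "count_neg (take_negs N (rev (sort_key fst Q))) \<le> length (take_negs N (rev (sort_key fst Q)))"
      by (simp add: count_neg_def)
    ultimately show ?thesis using length_take_negs_le[of N "rev (sort_key fst Q)"] by simp
  qed
  have "ln (16::real) \<le> 3"
  proof -
    have "ln (16::real) = 4 * ln 2" using ln_realpow[of 2 4] by simp
    thus ?thesis using ln_2_less_1 ln2_le_25_over_36 by simp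
  qed
  moreover have "ln (8 / (\<delta> / 2)) = ln 16 + l" using \<delta> by (simp add: l_def ln_div)
  ultimately have "14 * ln (8 / (\<delta> / 2)) \<le> 42 + 14 * l" by simp
  hence "real k \<le> 43 + 14 * l" unfolding k_def using l by linarith
  hence k: "real (2 * k + 1) \<le> 87 * (1 + l)" using l by simp
  have "ln (c / (\<delta> / 2)) = ln (2 * c) + l" using \<delta> C by (simp add: l_def ln_div ln_mult)
  \<comment> \<open>The constant is \<open>129600 = (5 * 72)\<^sup>2\<close>.\<close>
  hence mag: "m_ag C c (\<alpha> / 5 / 72) (\<delta> / 2) 1 = 129600 * C * (1 + ln (2 * c) + l) / \<alpha>\<^sup>2"
    by (simp add: m_ag_def power2_eq_square algebra_simps)
  have lc: "0 \<le> ln (2 * c)" using C by simp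
  have "1 + ln (2 * c) + l \<le> (1 + ln (2 * c)) * (1 + l)" using lc l by (simp add: algebra_simps)
  hence "129600 * C * (1 + ln (2 * c) + l) / \<alpha>\<^sup>2 \<le> 129600 * C * ((1 + ln (2 * c)) * (1 + l)) / \<alpha>\<^sup>2"
    using C by (intro divide_right_mono mult_left_mono) auto
  moreover have "0 \<le> 129600 * C * (1 + ln (2 * c) + l) / \<alpha>\<^sup>2" using C lc l by simp
  ultimately have n2: "real n2 \<le> 129600 * C * ((1 + ln (2 * c)) * (1 + l)) / \<alpha>\<^sup>2 + 1"
    unfolding n2_def mag by linarith
  have "count_neg S2 \<le> n2" using S2 by (simp add: count_neg_def flip: S2)
  hence "real (snd r) \<le> 87 * (1 + l) + 1 + 129600 * C * ((1 + ln (2 * c)) * (1 + l)) / \<alpha>\<^sup>2"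
    using s c1 k n2 unfolding N_def[symmetric] by linarith
  also have "87 * (1 + l) + 1 \<le> 88 * (1 + l) / 1" using l by simp
  also have "88 * (1 + l) / 1 \<le> 88 * (1 + l) / \<alpha>\<^sup>2"
    using l \<alpha> by (intro divide_left_mono) (auto simp: power_le_one)
  finally show ?thesis by (simp add: l_def add_divide_distrib algebra_simps)
qed

text \<open>The pool comes from a general measure and the later draws from a \<open>pmf\<close>, so
  the success probability is the conditional one integrated over the pool. The factor
  \<open>K\<close> depends on \<open>C\<close> and \<open>c\<close> only.\<close>

theorem theorem1:
  shows "\<exists>C0>0. \<exists>c0>0. \<forall>C\<ge>C0. \<forall>c\<ge>c0. \<exists>K::real.
    \<forall>(\<eta>::real) (\<delta>::real) (\<alpha>::real) (D::point measure).
      \<eta> \<in> {0<..<1} \<and> \<delta> \<in> {0<..<1} \<and> \<alpha> \<in> {0<..<1} \<and>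
      prob_space D \<and> sets D = sets (borel :: point measure) \<and>
      (AE p in D. fst p \<in> {0..1} \<and> snd p \<in> {-1, 1}) \<and>
      err_H D \<le> \<eta>
      \<longrightarrow>
      (\<forall>S0. length S0 = pool_size C c \<eta> \<delta> \<alpha> \<longrightarrow>
          (\<forall>r \<in> set_pmf (audit_thr C c \<eta> \<delta> \<alpha> S0).
              real (snd r) \<le> K * (1 + ln (1 / \<delta>)) / \<alpha>\<^sup>2)) \<and>
      (\<integral>\<^sup>+ S. ennreal (measure_pmf.prob
                 (audit_thr C c \<eta> \<delta> \<alpha> (map S [0..<pool_size C c \<eta> \<delta> \<alpha>]))
                 {r. err_D D (thr (fst r)) \<le> (1 + \<alpha>) * \<eta>})
         \<partial>(PiM {..<pool_size C c \<eta> \<delta> \<alpha>} (\<lambda>_. D)))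
        \<ge> ennreal (1 - \<delta>)"
proof (rule exI[of _ 1000000], intro conjI, simp, rule exI[of _ 100], intro conjI allI impI, simp, goal_cases)
  case (1 C c)
  show ?case
  proof (rule exI[of _ "88 + 129600 * C * (1 + ln (2 * c))"], intro allI impI, elim conjE, rule conjI)
    fix \<eta> \<delta> \<alpha> :: real and D :: "point measure"
    assume "\<eta> \<in> {0<..<1}" "\<delta> \<in> {0<..<1}" "\<alpha> \<in> {0<..<1}"
      and D: "prob_space D" "sets D = sets borel"
      and ae: "AE p in D. fst p \<in> {0..1} \<and> snd p \<in> {-1, 1}" and errH: "err_H D \<le> \<eta>"
    hence p: "0 < \<eta>" "\<eta> < 1" "0 < \<delta>" "\<delta> < 1" "0 < \<alpha>" "\<alpha> < 1" by auto
    have C: "1000000 \<le> C" "100 \<le> c" using 1 by auto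
    show "\<forall>S0. length S0 = pool_size C c \<eta> \<delta> \<alpha> \<longrightarrow> (\<forall>r \<in> set_pmf (audit_thr C c \<eta> \<delta> \<alpha> S0).
        real (snd r) \<le> (88 + 129600 * C * (1 + ln (2 * c))) * (1 + ln (1 / \<delta>)) / \<alpha>\<^sup>2)"
      using audit_thr_queries[of C c \<eta> \<delta> \<alpha>] C p by auto
    define m where "m = pool_size C c \<eta> \<delta> \<alpha>"
    define P where "P = PiM {..<m} (\<lambda>_. D)"
    let ?G = "{r. err_D D (thr (fst r)) \<le> (1 + \<alpha>) * \<eta>}"
    have lab: "AE p in D. snd p \<in> {-1, 1}" using ae by eventually_elim auto
    \<comment> \<open>The slack \<open>\<alpha> / 40 = \<nu> / 8\<close> gives a threshold even if
      the infimum is not attained.\<close>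
    have "\<eta> < (1 + \<alpha> / 40) * \<eta>" using p by (simp add: distrib_right)
    hence "err_H D < (1 + \<alpha> / 40) * \<eta>" using errH by linarith
    moreover have "bdd_below ((\<lambda>a. err_D D (thr a)) ` {0..1})"
      by (rule bdd_belowI[of _ 0]) (auto simp: err_D_def)
    ultimately obtain a where a: "a \<in> {0..1}" "err_D D (thr a) < (1 + \<alpha> / 40) * \<eta>"
      unfolding err_H_def by (subst (asm) cINF_less_iff) auto
    obtain E where E: "E \<in> sets P" "1 - \<delta> / 4 \<le> measure P E"
      "\<And>S. S \<in> E \<Longrightarrow> mistakes a (map S [0..<m]) \<le> (1 + \<alpha> / 20) * \<eta> * m"
      "\<And>S b. S \<in> E \<Longrightarrow> mistakes b (map S [0..<m]) \<le> (1 + 2 * (\<alpha> / 5)) * \<eta> * m \<Longrightarrow> err_D D (thr b) \<le> (1 + \<alpha>) * \<eta>"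
      using good_pool_event[OF C p D lab less_imp_le[OF a(2)]] unfolding P_def m_def by blast
    interpret D: prob_space D by (rule D)
    interpret PP: product_prob_space "\<lambda>_::nat. D" "{..<m}" by unfold_locales
    interpret P: prob_space P unfolding P_def by (rule PP.prob_space_axioms)
    \<comment> \<open>The pool fails with probability at most \<open>\<delta> / 4\<close>, and the
      algorithm on a good pool with at most \<open>\<delta> / 2\<close>.\<close>
    have "(1 - \<delta> / 2) * (1 - \<delta> / 4) \<le> (1 - \<delta> / 2) * measure P E"
      using E(2) p by (intro mult_left_mono) auto
    moreover have "1 - \<delta> \<le> (1 - \<delta> / 2) * (1 - \<delta> / 4)" using p by (simp add: algebra_simps)
    ultimately have "ennreal (1 - \<delta>) \<le> ennreal ((1 - \<delta> / 2) * measure P E)" by (intro ennreal_leI) simp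
    also have "\<dots> = (\<integral>\<^sup>+ S. ennreal (1 - \<delta> / 2) * indicator E S \<partial>P)"
      using E(1) p by (simp add: nn_integral_cmult P.emeasure_eq_measure ennreal_mult)
    also have "\<dots> \<le> (\<integral>\<^sup>+ S. ennreal (measure_pmf.prob (audit_thr C c \<eta> \<delta> \<alpha> (map S [0..<m])) ?G) \<partial>P)"
    proof (rule nn_integral_mono)
      fix S
      show "ennreal (1 - \<delta> / 2) * indicator E S \<le> ennreal (measure_pmf.prob (audit_thr C c \<eta> \<delta> \<alpha> (map S [0..<m])) ?G)"
      proof (cases "S \<in> E")
        case True
        have "1 \<le> \<eta> * m" unfolding m_def using C p by (rule pool_size_bounds)
        hence "measure_pmf.prob (audit_thr C c \<eta> \<delta> \<alpha> (map S [0..<m])) {r. \<not> err_D D (thr (fst r)) \<le> (1 + \<alpha>) * \<eta>} \<le> \<delta> / 2"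
          using E(3,4)[OF True] by (intro audit_thr_good_pool[OF C p a(1)]) auto
        moreover have "measure_pmf.prob (audit_thr C c \<eta> \<delta> \<alpha> (map S [0..<m])) {r. \<not> err_D D (thr (fst r)) \<le> (1 + \<alpha>) * \<eta>} =
           1 - measure_pmf.prob (audit_thr C c \<eta> \<delta> \<alpha> (map S [0..<m])) ?G"
          using measure_pmf.prob_compl[of ?G "audit_thr C c \<eta> \<delta> \<alpha> (map S [0..<m])"]
          by (simp add: set_diff_eq)
        ultimately show ?thesis using True by (simp add: ennreal_leI)
      qed simp
    qed
    finally show "ennreal (1 - \<delta>) \<le> (\<integral>\<^sup>+ S. ennreal (measure_pmf.prob
                 (audit_thr C c \<eta> \<delta> \<alpha> (map S [0..<pool_size C c \<eta> \<delta> \<alpha>])) ?G)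
         \<partial>(PiM {..<pool_size C c \<eta> \<delta> \<alpha>} (\<lambda>_. D)))"
      unfolding P_def m_def .
  qed
qed

end
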